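(* Let $\Phi:\mathbb D\to\mathbb C\cup\{\infty\}$ be a meromorphic function such that $\Phi(0)=0$ and $|\Phi(z)|\ge|z|$ for all $z\in\mathbb D$. Then: (1) For every $\alpha\in\mathbb D$ there exists a unique $z\in\mathbb D$ such that $\Phi(z)=\alpha$. (2) There exists a continuous function $\omega:\overline{\mathbb D}\to\overline{\mathbb D}$ such that $\omega(\mathbb D)\subset\mathbb D$, $\omega|_{\mathbb D}$ is analytic, and $\Phi(\omega(z))=z$ for $z\in\mathbb D$. (3) For each $\alpha\in\overline{\mathbb D}$, $\omega(\alpha)$ is the Denjoy-Wolff point of the map $g_\alpha:\mathbb D\to\overline{\mathbb D}$ defined by $g_\alpha(z)=\frac{\alpha z}{\Phi(z)}$, $z\in\mathbb D$. (4) The function $\omega$ is one-to-one. (5) If $\zeta\in\mathbb T$ is such that $|\omega(\zeta)|<1$, then $\omega$ can be continued analytically to a neighborhood of $\zeta$.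
   Context: $\mathbb D=\{z\in\mathbb C:|z|<1\}$, $\mathbb T=\partial\mathbb D$. In the definition of $g_\alpha$ the removable singularity at $z=0$ is filled in ($g_\alpha(0)=\alpha/\Phi'(0)$), and $g_\alpha=0$ at poles of $\Phi$. For an analytic $f:\mathbb D\to\overline{\mathbb D}$, a point $w\in\overline{\mathbb D}$ is a Denjoy-Wolff point of $f$ if either $|w|<1$ and $f(w)=w$, or $|w|=1$, the nontangential limit of $f$ at $w$ equals $w$, and the nontangential limit of $\frac{f(z)-w}{z-w}$ as $z\to w$ exists and is $\le1$. Every such $f$ other than the identity has exactly one Denjoy-Wolff point. *)

theory Defs
  imports "HOL-Complex_Analysis.Complex_Analysis"
begin

definition stolz_region :: "real \<Rightarrow> complex \<Rightarrow> complex set" where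
  "stolz_region k w = {z \<in> ball 0 1. norm (z - w) < k * (1 - norm z)}"

text \<open>Only meaningful for \<open>norm w = 1\<close>; each aperture \<open>k > 1\<close> is then approached nontrivially.\<close>

definition nontangential_limit :: "(complex \<Rightarrow> complex) \<Rightarrow> complex \<Rightarrow> complex \<Rightarrow> bool" where
  "nontangential_limit f w L \<longleftrightarrow> (\<forall>k>1. (f \<longlongrightarrow> L) (at w within stolz_region k w))"

text \<open>The first two conjuncts express that \<open>f\<close> is an analytic map from the open unit disc to the
  closed one. The number \<open>c\<close> is real: the limit of the difference quotient is required to be
  a real number not exceeding \<open>1\<close>.\<close>

definition denjoy_wolff_point :: "(complex \<Rightarrow> complex) \<Rightarrow> complex \<Rightarrow> bool" where
  "denjoy_wolff_point f w \<longleftrightarrow>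
     f holomorphic_on ball 0 1 \<and> f ` ball 0 1 \<subseteq> cball 0 1 \<and>
     (norm w < 1 \<and> f w = w \<or>
      norm w = 1 \<and> nontangential_limit f w w \<and>
        (\<exists>c::real. c \<le> 1 \<and> nontangential_limit (\<lambda>z. (f z - w) / (z - w)) w (of_real c)))"

text \<open>A meromorphic map \<open>\<Phi>\<close> to the Riemann sphere is represented by a function that is
  nicely meromorphic in the sense of the library: it is continuous off its poles and
  takes the dummy value \<open>0\<close> at its poles. Thus \<open>\<Phi>\<close> takes the finite value \<open>a\<close> at \<open>z\<close> iff
  \<open>\<not> is_pole \<Phi> z \<and> \<Phi> z = a\<close>, and the value \<open>\<infinity>\<close> iff \<open>is_pole \<Phi> z\<close>.\<close>

definition g_map :: "(complex \<Rightarrow> complex) \<Rightarrow> complex \<Rightarrow> complex \<Rightarrow> complex" where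
  "g_map \<Phi> \<alpha> z =
     (if z = 0 then \<alpha> / deriv \<Phi> 0 else if is_pole \<Phi> z then 0 else \<alpha> * z / \<Phi> z)"

end

theory Submission imports Defs begin

text \<open>With \<open>h z = z / \<Phi> z\<close>, which is an analytic map of the disc into the closed disc with \<open>h 0 \<noteq> 0\<close>, the
  equation \<open>\<Phi> z = \<alpha>\<close> says that \<open>z\<close> is a fixed point of \<open>g\<^sub>\<alpha> = \<alpha> h\<close>. By the Schwarz-Pick lemma and the
  Julia-Caratheodory theorem, the Denjoy-Wolff points of a disc map \<open>f\<close> are exactly the points \<open>w\<close> of the
  closed disc for which Wolff's inequality
  \<open>|1 - cnj w f z|\<^sup>2 / (1 - |f z|\<^sup>2) \<le> |1 - cnj w z|\<^sup>2 / (1 - |z|\<^sup>2)\<close> holds for all \<open>z\<close>.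
  In the coordinate \<open>2 w / (1 + |w|\<^sup>2)\<close> of the Klein model this inequality is affine, so two solutions
  would produce two interior ones, that is, two fixed points, and \<open>f\<close> would be the identity.
  The condition is closed in \<open>(\<alpha>, w)\<close>, so compactness gives existence for \<open>|\<alpha>| = 1\<close> from Brouwer's theorem
  for \<open>|\<alpha>| < 1\<close>, and the solution \<open>w = \<omega> \<alpha>\<close> has a closed graph, hence is continuous.\<close>

section \<open>The Schwarz-Pick lemma and rigidity\<close>

text \<open>For the disc automorphism with zero \<open>a\<close>, of modulus
  \<open>|z - a| / |1 - cnj a * z|\<close>, this computes one minus the squared modulus. It converts
  pseudo-hyperbolic estimates into the denominator-free product form used below.\<close>

lemma norm_one_minus_cnj_mult:
  "(norm (1 - cnj a * z))\<^sup>2 = (1 - (norm a)\<^sup>2) * (1 - (norm z)\<^sup>2) + (norm (z - a))\<^sup>2"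
  by (simp only: cmod_power2) (simp add: algebra_simps power2_eq_square)

lemma one_minus_cnj_mult_nonzero:
  assumes "norm a \<le> 1" "norm z < 1"
  shows "1 - cnj a * z \<noteq> 0"
proof
  assume "1 - cnj a * z = 0"
  then have "norm a * norm z = 1"
    by (metis complex_mod_cnj norm_mult norm_one right_minus_eq)
  moreover have "norm a * norm z \<le> norm z"
    using assms(1) by (simp add: mult_left_le_one_le)
  ultimately show False using assms(2) by simp
qed

text \<open>Automorphisms moving \<open>a\<close> and \<open>f a\<close> to 0 turn \<open>f\<close>
  into a map \<open>g\<close> with \<open>g 0 = 0\<close>, to which Schwarz's lemma applies. After
  squaring, \<open>norm_one_minus_cnj_mult\<close> gives the product form, since the remaining terms
  on the two sides cancel.\<close>

lemma Schwarz_Pick_open: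
  assumes f: "f holomorphic_on ball 0 1" and fD: "\<And>z. norm z < 1 \<Longrightarrow> norm (f z) < 1"
    and a: "norm a < 1" and z: "norm z < 1"
  shows "(norm (1 - cnj (f a) * f z))\<^sup>2 * ((1 - (norm a)\<^sup>2) * (1 - (norm z)\<^sup>2))
    \<le> (norm (1 - cnj a * z))\<^sup>2 * ((1 - (norm (f a))\<^sup>2) * (1 - (norm (f z))\<^sup>2))"
proof -
  define g where "g = Moebius_function 0 (f a) \<circ> (f \<circ> Moebius_function 0 (-a))"
  have M: "norm (Moebius_function 0 b x) < 1" if "norm b < 1" "norm x < 1" for b x
    using Moebius_function_norm_lt_1 that by blast
  have na: "norm (- a) < 1" using a by simp
  have holg: "g holomorphic_on ball 0 1"
    unfolding g_def
    by (intro holomorphic_on_compose_gen[where t = "ball 0 1"] f Moebius_function_holomorphic na fD a)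
      (use M[OF na] M[OF fD[OF a]] fD in auto)
  have g0: "g 0 = 0"
    by (simp add: g_def Moebius_function_def)
  have g1: "norm (g x) < 1" if "norm x < 1" for x
    unfolding g_def o_def by (intro M fD a na that)
  have "norm (g (Moebius_function 0 a z)) \<le> norm (Moebius_function 0 a z)"
    by (rule Schwarz_Lemma(1)[OF holg g0 g1 M[OF a z]])
  moreover have "Moebius_function 0 (-a) (Moebius_function 0 a z) = z"
    using Moebius_function_compose[of "-a" a z] a z by simp
  ultimately have *: "norm (f z - f a) / norm (1 - cnj (f a) * f z) \<le> norm (z - a) / norm (1 - cnj a * z)"
    by (simp add: g_def Moebius_function_simple norm_divide)
  have "1 - cnj a * z \<noteq> 0" "1 - cnj (f a) * f z \<noteq> 0"
    using one_minus_cnj_mult_nonzero a z fD by (auto simp: less_imp_le)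
  with * have "norm (f z - f a) * norm (1 - cnj a * z) \<le> norm (z - a) * norm (1 - cnj (f a) * f z)"
    by (simp add: divide_simps mult.commute)
  then have "(norm (f z - f a) * norm (1 - cnj a * z))\<^sup>2 \<le> (norm (z - a) * norm (1 - cnj (f a) * f z))\<^sup>2"
    by (intro power_mono) auto
  then show ?thesis
    unfolding power_mult_distrib norm_one_minus_cnj_mult by (simp add: algebra_simps)
qed

text \<open>Multiplying out the denominators keeps the inequality meaningful where \<open>norm (f z) = 1\<close>.\<close>

lemma Schwarz_Pick:
  assumes f: "f holomorphic_on ball 0 1" and fD: "f ` ball 0 1 \<subseteq> cball 0 1"
    and a: "norm a < 1" and z: "norm z < 1"
  shows "(norm (1 - cnj (f a) * f z))\<^sup>2 * ((1 - (norm a)\<^sup>2) * (1 - (norm z)\<^sup>2))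
    \<le> (norm (1 - cnj a * z))\<^sup>2 * ((1 - (norm (f a))\<^sup>2) * (1 - (norm (f z))\<^sup>2))"
proof (rule tendsto_le)
  \<comment> \<open>For \<open>0 < t < 1\<close> the map \<open>t * f\<close> has values in the open
    disc, so the open case applies; then t tends to 1.\<close>
  let ?L = "\<lambda>t. (norm (1 - cnj (of_real t * f a) * (of_real t * f z)))\<^sup>2 * ((1 - (norm a)\<^sup>2) * (1 - (norm z)\<^sup>2))"
  let ?R = "\<lambda>t. (norm (1 - cnj a * z))\<^sup>2 * ((1 - (norm (of_real t * f a))\<^sup>2) * (1 - (norm (of_real t * f z))\<^sup>2))"
  show "\<forall>\<^sub>F t in at_left 1. ?L t \<le> ?R t"
  proof -
    have "\<forall>\<^sub>F t in at_left 1. t \<in> {0<..<1::real}"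
      by (rule eventually_at_left_real) simp
    then show ?thesis
    proof eventually_elim
      case (elim t)
      have "norm (of_real t * f x) < 1" if "norm x < 1" for x
      proof -
        have "norm (f x) \<le> 1" using fD that by (simp add: image_subset_iff)
        then have "t * norm (f x) \<le> t" using elim by (simp add: mult_left_le)
        also have "\<dots> < 1" using elim by simp
        finally show ?thesis using elim by (simp add: norm_mult)
      qed
      then show ?case
        by (intro Schwarz_Pick_open[where f = "\<lambda>x. of_real t * f x"] a z) (intro holomorphic_intros f)
    qed
  qed
  show "(?L \<longlongrightarrow> (norm (1 - cnj (f a) * f z))\<^sup>2 * ((1 - (norm a)\<^sup>2) * (1 - (norm z)\<^sup>2))) (at_left 1)"
    by (auto intro!: tendsto_eq_intros)
  show "(?R \<longlongrightarrow> (norm (1 - cnj a * z))\<^sup>2 * ((1 - (norm (f a))\<^sup>2) * (1 - (norm (f z))\<^sup>2))) (at_left 1)"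
    by (auto intro!: tendsto_eq_intros)
qed auto

text \<open>Moving \<open>p\<close> to 0 by an automorphism, either alternative in
  \<open>rigid\<close> is an equality case of Schwarz's lemma. The conjugated map is then a
  rotation, and its multiplier is 1.\<close>

lemma disc_map_eq_id:
  assumes f: "f holomorphic_on ball 0 1" and fD: "f ` ball 0 1 \<subseteq> cball 0 1"
    and p: "norm p < 1" "f p = p"
    and rigid: "deriv f p = 1 \<or> (\<exists>q. norm q < 1 \<and> q \<noteq> p \<and> f q = q)"
    and z: "norm z < 1"
  shows "f z = z"
proof -
  let ?\<phi> = "Moebius_function 0 p" and ?\<psi> = "Moebius_function 0 (-p)"
  have np: "norm (- p) < 1" using p by simp
  have M: "norm (Moebius_function 0 b x) < 1" if "norm b < 1" "norm x < 1" for b x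
    using Moebius_function_norm_lt_1 that by blast
  \<comment> \<open>A value of norm 1 would make \<open>f\<close> constant by the maximum principle,
    but the value \<open>p\<close> at \<open>p\<close> is interior.\<close>
  have fD': "norm (f x) < 1" if "norm x < 1" for x
  proof (rule ccontr)
    assume "\<not> norm (f x) < 1"
    then have "norm (f x) = 1" using fD that by (auto simp: image_subset_iff not_less dest: spec[of _ x] intro: antisym)
    then have "f constant_on ball 0 1"
      by (intro maximum_modulus_principle[OF f, where U = "ball 0 1" and \<xi> = x])
        (use fD that in \<open>simp_all add: image_subset_iff\<close>)
    then have "f x = f p" using that p unfolding constant_on_def by auto
    then show False using p \<open>norm (f x) = 1\<close> by simp
  qed
  define g where "g = ?\<phi> \<circ> (f \<circ> ?\<psi>)"
  have inv1: "?\<psi> (?\<phi> x) = x" and inv2: "?\<phi> (?\<psi> x) = x" if "norm x < 1" for x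
    using Moebius_function_compose[of "-p" p x] Moebius_function_compose[of p "-p" x] p that by auto
  have hol: "?\<phi> holomorphic_on ball 0 1" "?\<psi> holomorphic_on ball 0 1"
    using Moebius_function_holomorphic p(1) np by blast+
  have holg: "g holomorphic_on ball 0 1"
    unfolding g_def
    by (intro holomorphic_on_compose_gen[where t = "ball 0 1"] f hol)
      (use M[OF np] M[OF p(1)] fD' in auto)
  have \<psi>0: "?\<psi> 0 = p" and \<phi>p: "?\<phi> p = 0" by (simp_all add: Moebius_function_def)
  have g0: "g 0 = 0"
    by (simp add: g_def \<psi>0 \<phi>p p)
  have g1: "norm (g x) < 1" if "norm x < 1" for x
    unfolding g_def o_def by (intro M fD' p(1) np that)
  have "\<exists>k. k \<noteq> 0 \<and> norm k < 1 \<and> g k = k" if q: "norm q < 1" "q \<noteq> p" "f q = q" for q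
  proof (intro exI conjI)
    show "?\<phi> q \<noteq> 0"
      using inv1[of q] \<psi>0 q by metis
    show "norm (?\<phi> q) < 1" using M p q by blast
    show "g (?\<phi> q) = ?\<phi> q" by (simp add: g_def inv1 q)
  qed
  moreover have "deriv g 0 = 1" if d: "deriv f p = 1"
  proof -
    have D\<psi>: "(?\<psi> has_field_derivative deriv ?\<psi> 0) (at 0)"
      by (intro holomorphic_derivI[OF hol(2)]) auto
    have D\<phi>: "(?\<phi> has_field_derivative deriv ?\<phi> p) (at p)"
      using p by (intro holomorphic_derivI[OF hol(1)]) auto
    have Df: "(f has_field_derivative 1) (at p)"
      using holomorphic_derivI[OF f, of p] p d by auto
    \<comment> \<open>The two automorphisms are mutually inverse, so their derivatives at
      \<open>p\<close> and 0 multiply to 1 and conjugation preserves the derivative at the fixed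
      point.\<close>
    have "(?\<phi> \<circ> ?\<psi> has_field_derivative deriv ?\<phi> p * deriv ?\<psi> 0) (at 0)"
      by (rule DERIV_chain) (use D\<psi> D\<phi> \<psi>0 in auto)
    moreover have "(?\<phi> \<circ> ?\<psi> has_field_derivative 1) (at 0)"
      by (rule has_field_derivative_transform_within_open[OF DERIV_ident, of "ball 0 1"]) (auto simp: inv2)
    ultimately have *: "deriv ?\<phi> p * deriv ?\<psi> 0 = 1" by (rule DERIV_unique)
    have "(f \<circ> ?\<psi> has_field_derivative 1 * deriv ?\<psi> 0) (at 0)"
      by (rule DERIV_chain) (use D\<psi> Df \<psi>0 in auto)
    then have "(g has_field_derivative deriv ?\<phi> p * (1 * deriv ?\<psi> 0)) (at 0)"
      unfolding g_def by (rule DERIV_chain[rotated]) (use D\<phi> \<psi>0 p in auto)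
    then show ?thesis using * by (simp add: DERIV_imp_deriv)
  qed
  ultimately have k: "(\<exists>k. norm k < 1 \<and> k \<noteq> 0 \<and> g k = k) \<or> deriv g 0 = 1"
    using rigid by blast
  then have "(\<exists>k. norm k < 1 \<and> k \<noteq> 0 \<and> norm (g k) = norm k) \<or> norm (deriv g 0) = 1"
    by auto
  from Schwarz_Lemma(3)[OF holg g0 g1 z this]
  obtain c where c: "\<And>x. norm x < 1 \<Longrightarrow> g x = c * x" by blast
  have "(g has_field_derivative c) (at 0)"
    by (rule has_field_derivative_transform_within_open[of "\<lambda>x. c * x" _ _ "ball 0 1"])
      (auto intro!: derivative_eq_intros simp: c)
  \<comment> \<open>Either \<open>c * k = k\<close> with \<open>k\<close> nonzero, or
    \<open>c\<close> equals \<open>deriv g 0 = 1\<close>.\<close>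
  then have "c = 1" using k c by (auto dest: DERIV_imp_deriv)
  then have "g (?\<phi> z) = ?\<phi> z" using c M p z by simp
  then have "?\<psi> (?\<phi> (f z)) = ?\<psi> (?\<phi> z)"
    by (simp add: g_def inv1 z)
  then show ?thesis by (simp add: inv1 z fD')
qed

section \<open>Wolff's inequality\<close>

text \<open>Wolff's inequality: \<open>f\<close> maps the hyperbolic discs centred at \<open>w\<close> (for \<open>norm w = 1\<close>: the horodiscs
  at \<open>w\<close>) into themselves.\<close>

definition wolff_ineq :: "(complex \<Rightarrow> complex) \<Rightarrow> complex \<Rightarrow> bool" where
  "wolff_ineq f w \<longleftrightarrow> (\<forall>z\<in>ball 0 1.
     (norm (1 - cnj w * f z))\<^sup>2 * (1 - (norm z)\<^sup>2) \<le> (norm (1 - cnj w * z))\<^sup>2 * (1 - (norm (f z))\<^sup>2))"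

text \<open>At \<open>z = w\<close> the two sides differ by a positive multiple of
  \<open>|f w - w|^2\<close>, which must therefore vanish. Conversely, for a fixed point
  \<open>w\<close> the inequality is Schwarz-Pick based at \<open>w\<close>, divided by
  \<open>1 - |w|^2\<close>.\<close>

lemma wolff_ineq_interior_iff:
  assumes f: "f holomorphic_on ball 0 1" and fD: "f ` ball 0 1 \<subseteq> cball 0 1" and w: "norm w < 1"
  shows "wolff_ineq f w \<longleftrightarrow> f w = w"
proof
  have pos: "0 < 1 - (norm w)\<^sup>2"
    using w by (simp add: power_less_one_iff)
  {
    assume "wolff_ineq f w"
    then have "(norm (1 - cnj w * f w))\<^sup>2 * (1 - (norm w)\<^sup>2)
        \<le> (norm (1 - cnj w * w))\<^sup>2 * (1 - (norm (f w))\<^sup>2)"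
      using w unfolding wolff_ineq_def by simp
    also have "\<dots> = ((1 - (norm w)\<^sup>2) * (1 - (norm (f w))\<^sup>2)) * (1 - (norm w)\<^sup>2)"
      unfolding norm_one_minus_cnj_mult by (simp add: algebra_simps)
    finally have "(norm (f w - w))\<^sup>2 \<le> 0"
      using pos unfolding norm_one_minus_cnj_mult by (simp add: mult_le_cancel_right)
    then show "f w = w" by simp
  next
    assume fw: "f w = w"
    show "wolff_ineq f w"
      unfolding wolff_ineq_def
    proof
      fix z :: complex assume z: "z \<in> ball 0 1"
      have "(norm (1 - cnj w * f z))\<^sup>2 * (1 - (norm z)\<^sup>2) * (1 - (norm w)\<^sup>2)
          \<le> (norm (1 - cnj w * z))\<^sup>2 * (1 - (norm (f z))\<^sup>2) * (1 - (norm w)\<^sup>2)"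
        using Schwarz_Pick[OF f fD w, of z] fw z by (simp add: mult_ac)
      then show "(norm (1 - cnj w * f z))\<^sup>2 * (1 - (norm z)\<^sup>2)
          \<le> (norm (1 - cnj w * z))\<^sup>2 * (1 - (norm (f z))\<^sup>2)"
        using pos by (simp add: mult_le_cancel_right)
    qed
  }
qed

text \<open>Passage from the Poincare model to the Klein model, in which Wolff's inequality is affine in
  the centre.\<close>

definition klein :: "complex \<Rightarrow> complex" where
  "klein w = (2 / (1 + (norm w)\<^sup>2)) *\<^sub>R w"

text \<open>With \<open>r = |w|\<close>, inverting \<open>klein\<close> means solving
  \<open>|v| (1 + r^2) = 2 r\<close>; this is the root in the unit interval, in a form that also
  covers \<open>v = 0\<close>.\<close>

definition klein_inv :: "complex \<Rightarrow> complex" where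
  "klein_inv v = (1 / (1 + sqrt (1 - (norm v)\<^sup>2))) *\<^sub>R v"

lemma klein_inv_klein:
  assumes "norm w \<le> 1"
  shows "klein_inv (klein w) = w"
proof -
  define r where "r = norm w"
  have r: "0 \<le> r" "r \<le> 1" using assms by (auto simp: r_def)
  have pos: "1 + r\<^sup>2 > 0" by (smt (verit) zero_le_power2)
  have "1 - (norm (klein w))\<^sup>2 = ((1 - r\<^sup>2) / (1 + r\<^sup>2))\<^sup>2"
    using pos by (simp add: klein_def r_def[symmetric] abs_of_pos power_mult_distrib power_divide divide_simps)
      (simp add: algebra_simps power2_eq_square)
  moreover have "0 \<le> (1 - r\<^sup>2) / (1 + r\<^sup>2)"
    using r pos by (intro divide_nonneg_pos) (auto simp: power_le_one)
  ultimately have "sqrt (1 - (norm (klein w))\<^sup>2) = (1 - r\<^sup>2) / (1 + r\<^sup>2)"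
    by (metis abs_of_nonneg real_sqrt_abs)
  then have eq: "1 + sqrt (1 - (norm (klein w))\<^sup>2) = 2 / (1 + r\<^sup>2)"
    using pos by (simp add: field_simps)
  have one: "1 / (2 / (1 + r\<^sup>2)) * (2 / (1 + r\<^sup>2)) = 1"
    using pos by (simp add: field_simps)
  show ?thesis
    unfolding klein_inv_def eq unfolding klein_def r_def[symmetric] scaleR_scaleR one by simp
qed

lemma klein_klein_inv:
  assumes "norm v \<le> 1"
  shows "klein (klein_inv v) = v"
proof -
  define s where "s = sqrt (1 - (norm v)\<^sup>2)"
  have s: "s \<ge> 0" "s\<^sup>2 = 1 - (norm v)\<^sup>2"
    using assms by (auto simp: s_def power_le_one)
  have "(norm (klein_inv v))\<^sup>2 = (1 - s\<^sup>2) / (1 + s)\<^sup>2"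
    using s by (simp add: klein_inv_def s_def[symmetric] power_divide)
  also have "\<dots> = (1 - s) / (1 + s)"
    using s(1) by (simp add: divide_simps) (simp add: algebra_simps power2_eq_square)
  finally have "1 + (norm (klein_inv v))\<^sup>2 = 2 / (1 + s)"
    using s(1) by (simp add: field_simps)
  then show ?thesis
    using s(1) unfolding klein_def by (simp add: klein_inv_def s_def[symmetric])
qed

lemma norm_klein_le:
  "norm (klein w) \<le> 1"
proof -
  have "0 \<le> (1 - norm w)\<^sup>2" by simp
  then have "2 * norm w \<le> 1 + (norm w)\<^sup>2" by (simp add: power2_diff)
  then have "2 * norm w / (1 + (norm w)\<^sup>2) \<le> 1" by (subst divide_le_eq_1_pos) (smt (verit) zero_le_power2)+
  then show ?thesis by (simp add: klein_def)
qed

lemma norm_klein_inv_less: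
  assumes "norm v < 1"
  shows "norm (klein_inv v) < 1"
proof -
  have s: "0 \<le> sqrt (1 - (norm v)\<^sup>2)" using assms by (simp add: power_le_one)
  have "norm (klein_inv v) = norm v / (1 + sqrt (1 - (norm v)\<^sup>2))"
    using s by (simp add: klein_inv_def)
  also have "\<dots> < 1" using s assms by (subst divide_less_eq_1_pos) linarith+
  finally show ?thesis .
qed

text \<open>Both sides are affine in the Klein coordinate \<open>v\<close> of the centre, so the
  solutions \<open>v\<close> form a convex set.\<close>

definition klein_ineq :: "(complex \<Rightarrow> complex) \<Rightarrow> complex \<Rightarrow> bool" where
  "klein_ineq f v \<longleftrightarrow> (\<forall>z\<in>ball 0 1.
     (1 + (norm (f z))\<^sup>2 - 2 * (v \<bullet> f z)) * (1 - (norm z)\<^sup>2) \<le> (1 + (norm z)\<^sup>2 - 2 * (v \<bullet> z)) * (1 - (norm (f z))\<^sup>2))"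

text \<open>Up to the factor \<open>r = 1 + |w|^2\<close>, each \<open>2 |1 - cnj w * x|^2\<close>
  is the Klein expression plus a term in \<open>(1 - |w|^2) (1 - |x|^2)\<close>. Multiplied by the
  opposite factor, that extra term becomes the same on both sides and cancels.\<close>

lemma wolff_ineq_iff_klein_ineq: "wolff_ineq f w \<longleftrightarrow> klein_ineq f (klein w)"
  unfolding wolff_ineq_def klein_ineq_def
proof (intro ball_cong refl)
  fix z :: complex
  define r where "r = 1 + (norm w)\<^sup>2"
  have r: "r > 0" unfolding r_def by (smt (verit) zero_le_power2)
  have *: "2 * (norm (1 - cnj w * x))\<^sup>2
      = r * (1 + (norm x)\<^sup>2 - 2 * (klein w \<bullet> x)) + (1 - (norm w)\<^sup>2) * (1 - (norm x)\<^sup>2)" for x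
  proof -
    have "r * (klein w \<bullet> x) = 2 * (w \<bullet> x)" using r by (simp add: klein_def r_def[symmetric])
    moreover have "(norm (1 - cnj w * x))\<^sup>2 = 1 - 2 * (w \<bullet> x) + (norm w)\<^sup>2 * (norm x)\<^sup>2"
      by (simp only: cmod_power2) (simp add: inner_complex_def algebra_simps power2_eq_square)
    ultimately show ?thesis by (simp add: algebra_simps r_def)
  qed
  let ?L = "1 + (norm (f z))\<^sup>2 - 2 * (klein w \<bullet> f z)" and ?R = "1 + (norm z)\<^sup>2 - 2 * (klein w \<bullet> z)"
  have "(norm (1 - cnj w * f z))\<^sup>2 * (1 - (norm z)\<^sup>2) \<le> (norm (1 - cnj w * z))\<^sup>2 * (1 - (norm (f z))\<^sup>2)
    \<longleftrightarrow> 2 * (norm (1 - cnj w * f z))\<^sup>2 * (1 - (norm z)\<^sup>2) \<le> 2 * (norm (1 - cnj w * z))\<^sup>2 * (1 - (norm (f z))\<^sup>2)"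
    by simp
  also have "\<dots> \<longleftrightarrow> r * (?L * (1 - (norm z)\<^sup>2)) \<le> r * (?R * (1 - (norm (f z))\<^sup>2))"
    unfolding * by (simp add: algebra_simps)
  also have "\<dots> \<longleftrightarrow> ?L * (1 - (norm z)\<^sup>2) \<le> ?R * (1 - (norm (f z))\<^sup>2)"
    using r by simp
  finally show "(norm (1 - cnj w * f z))\<^sup>2 * (1 - (norm z)\<^sup>2) \<le> (norm (1 - cnj w * z))\<^sup>2 * (1 - (norm (f z))\<^sup>2)
    \<longleftrightarrow> ?L * (1 - (norm z)\<^sup>2) \<le> ?R * (1 - (norm (f z))\<^sup>2)" .
qed

lemma klein_ineq_midpoint:
  assumes "klein_ineq f u" "klein_ineq f v"
  shows "klein_ineq f (midpoint u v)"
  unfolding klein_ineq_def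
proof
  fix z :: complex assume z: "z \<in> ball 0 1"
  have "2 * (midpoint u v \<bullet> x) = u \<bullet> x + v \<bullet> x" for x
    by (simp add: midpoint_def inner_left_distrib)
  then show "(1 + (norm (f z))\<^sup>2 - 2 * (midpoint u v \<bullet> f z)) * (1 - (norm z)\<^sup>2)
      \<le> (1 + (norm z)\<^sup>2 - 2 * (midpoint u v \<bullet> z)) * (1 - (norm (f z))\<^sup>2)"
    using assms[unfolded klein_ineq_def, THEN bspec, OF z] by (simp add: algebra_simps)
qed

lemma norm_midpoint_less:
  fixes u v :: complex
  assumes "norm u \<le> 1" "norm v \<le> 1" "u \<noteq> v"
  shows "norm (midpoint u v) < 1"
  using dist_decreases_open_segment[of "midpoint u v" u v 0] assms by auto

lemma wolff_ineq_unique: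
  assumes f: "f holomorphic_on ball 0 1" and fD: "f ` ball 0 1 \<subseteq> cball 0 1"
    and nid: "\<exists>z\<in>ball 0 1. f z \<noteq> z"
    and w: "norm w1 \<le> 1" "wolff_ineq f w1" "norm w2 \<le> 1" "wolff_ineq f w2"
  shows "w1 = w2"
proof (rule ccontr)
  assume "w1 \<noteq> w2"
  then have ne: "klein w1 \<noteq> klein w2" using klein_inv_klein w by metis
  define m where "m = midpoint (klein w1) (klein w2)"
  \<comment> \<open>One midpoint yields only one interior fixed point. The second midpoint supplies
    another, as rigidity requires.\<close>
  define m' where "m' = midpoint (klein w1) m"
  have m1: "norm m < 1"
    unfolding m_def using ne norm_klein_le by (intro norm_midpoint_less) auto
  have ne1: "klein w1 \<noteq> m" using ne unfolding m_def by (metis midpoint_eq_endpoint(1))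
  then have m1': "norm m' < 1"
    unfolding m'_def using norm_klein_le m1 by (intro norm_midpoint_less) auto
  have "m' \<noteq> m" using ne1 unfolding m'_def by (metis midpoint_eq_endpoint(2))
  then have ne2: "klein_inv m' \<noteq> klein_inv m"
    using klein_klein_inv m1 m1' by (metis less_imp_le)
  have "klein_ineq f m"
    using w unfolding m_def wolff_ineq_iff_klein_ineq by (intro klein_ineq_midpoint)
  then have "klein_ineq f m'"
    using w unfolding m'_def wolff_ineq_iff_klein_ineq by (intro klein_ineq_midpoint)
  have fixed: "f (klein_inv v) = klein_inv v" if "klein_ineq f v" "norm v < 1" for v
    using wolff_ineq_interior_iff[OF f fD norm_klein_inv_less[OF that(2)]] that
    by (simp add: wolff_ineq_iff_klein_ineq klein_klein_inv)
  have "f z = z" if "norm z < 1" for z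
    by (rule disc_map_eq_id[OF f fD norm_klein_inv_less[OF m1] fixed[OF \<open>klein_ineq f m\<close> m1] _ that])
      (use ne2 norm_klein_inv_less[OF m1'] fixed[OF \<open>klein_ineq f m'\<close> m1'] in blast)
  then show False using nid by auto
qed

section \<open>The Julia-Caratheodory theorem\<close>

text \<open>The Cayley transform \<open>(u - 1) / (u + 1)\<close> carries the right half plane to
  the disc, and Schwarz-Pick is transported through it. The factors \<open>|u + 1|^2\<close> occur
  on both sides and cancel.\<close>

lemma Schwarz_Pick_Re_nonneg:
  assumes u: "u holomorphic_on ball 0 1" and pos: "\<And>z. norm z < 1 \<Longrightarrow> 0 \<le> Re (u z)"
    and a: "norm a < 1" and z: "norm z < 1"
  shows "(norm (u z + cnj (u a)))\<^sup>2 * ((1 - (norm a)\<^sup>2) * (1 - (norm z)\<^sup>2))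
    \<le> (norm (1 - cnj a * z))\<^sup>2 * (4 * Re (u a) * Re (u z))"
proof -
  define f where "f = (\<lambda>x. (u x - 1) / (u x + 1))"
  have nz: "u x + 1 \<noteq> 0" if "norm x < 1" for x
    using pos[OF that] by (auto simp: complex_eq_iff)
  have one_minus: "1 - (norm (f x))\<^sup>2 = 4 * Re (u x) / (norm (u x + 1))\<^sup>2" if "norm x < 1" for x
  proof -
    have "(norm (u x + 1))\<^sup>2 - (norm (u x - 1))\<^sup>2 = 4 * Re (u x)"
      by (simp only: cmod_power2) (simp add: algebra_simps power2_eq_square)
    then show ?thesis
      using nz[OF that] by (simp add: f_def norm_divide power_divide divide_simps)
  qed
  have "f holomorphic_on ball 0 1"
    unfolding f_def by (intro holomorphic_intros u) (use nz in auto)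
  moreover have "f ` ball 0 1 \<subseteq> cball 0 1"
  proof clarify
    fix x :: complex assume "x \<in> ball 0 1"
    then have "0 \<le> 1 - (norm (f x))\<^sup>2"
      using one_minus pos by simp
    then show "f x \<in> cball 0 1"
      by (simp add: power_le_one_iff abs_square_le_1)
  qed
  moreover have "(norm (1 - cnj (f a) * f z))\<^sup>2
      = 4 * (norm (u z + cnj (u a)))\<^sup>2 / ((norm (u a + 1))\<^sup>2 * (norm (u z + 1))\<^sup>2)"
  proof -
    have nz': "cnj (u a) + 1 \<noteq> 0"
      using nz[OF a] by (metis complex_cnj_add complex_cnj_cnj complex_cnj_one complex_cnj_zero)
    have eq: "1 - cnj (f a) * f z = 2 * (u z + cnj (u a)) / (cnj (u a + 1) * (u z + 1))"
      using nz[OF z] nz' by (simp add: f_def divide_simps) (simp add: algebra_simps)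
    show ?thesis
      unfolding eq norm_divide norm_mult complex_mod_cnj by (simp add: power_divide power_mult_distrib)
  qed
  ultimately have "4 * (norm (u z + cnj (u a)))\<^sup>2 / ((norm (u a + 1))\<^sup>2 * (norm (u z + 1))\<^sup>2)
        * ((1 - (norm a)\<^sup>2) * (1 - (norm z)\<^sup>2))
    \<le> (norm (1 - cnj a * z))\<^sup>2
        * (4 * Re (u a) / (norm (u a + 1))\<^sup>2 * (4 * Re (u z) / (norm (u z + 1))\<^sup>2))"
    using Schwarz_Pick[of f a z] a z by (simp only: one_minus)
  then have "4 * ((norm (u z + cnj (u a)))\<^sup>2 * ((1 - (norm a)\<^sup>2) * (1 - (norm z)\<^sup>2)))
        / ((norm (u a + 1))\<^sup>2 * (norm (u z + 1))\<^sup>2)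
    \<le> 4 * ((norm (1 - cnj a * z))\<^sup>2 * (4 * Re (u a) * Re (u z)))
        / ((norm (u a + 1))\<^sup>2 * (norm (u z + 1))\<^sup>2)"
    by (simp add: mult_ac)
  moreover have "0 < (norm (u a + 1))\<^sup>2 * (norm (u z + 1))\<^sup>2"
    using nz[OF a] nz[OF z] by simp
  ultimately have "4 * ((norm (u z + cnj (u a)))\<^sup>2 * ((1 - (norm a)\<^sup>2) * (1 - (norm z)\<^sup>2)))
    \<le> 4 * ((norm (1 - cnj a * z))\<^sup>2 * (4 * Re (u a) * Re (u z)))"
    by (simp only: divide_le_cancel)
  then show ?thesis by linarith
qed

section \<open>Nontangential limits of functions with nonnegative real part\<close>

lemma norm_one_minus_cnj_unimodular:
  assumes "norm w = 1"
  shows "norm (1 - cnj w * z) = norm (w - z)"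
proof -
  have "(norm (1 - cnj w * z))\<^sup>2 = (norm (w - z))\<^sup>2"
    unfolding norm_one_minus_cnj_mult using assms by (simp add: norm_minus_commute)
  then show ?thesis by simp
qed

text \<open>Replaces \<open>1 - |z|\<close> by the larger \<open>1 - |z|^2\<close>, the factor that
  occurs in Schwarz-Pick.\<close>

lemma stolz_region_bound:
  assumes "z \<in> stolz_region k w" "k > 1"
  shows "norm z < 1" "norm (w - z) \<le> k * (1 - (norm z)\<^sup>2)"
proof -
  have z: "norm z < 1" "norm (w - z) < k * (1 - norm z)"
    using assms by (auto simp: stolz_region_def norm_minus_commute)
  show "norm z < 1" by fact
  have "(norm z)\<^sup>2 \<le> norm z" using z(1) by (simp add: power2_eq_square mult_left_le)
  then have "k * (1 - norm z) \<le> k * (1 - (norm z)\<^sup>2)" using assms(2) by simp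
  then show "norm (w - z) \<le> k * (1 - (norm z)\<^sup>2)" using z(2) by simp
qed

lemma eventually_in_stolz: "\<forall>\<^sub>F z in at w within stolz_region k w. z \<in> stolz_region k w"
  by (simp add: eventually_at_filter)

text \<open>The hypothesis \<open>small\<close> says that the infimum of \<open>Re u\<close> over the Poisson kernel at \<open>w\<close> is \<open>0\<close>.\<close>

lemma nontangential_limit_zero:
  assumes u: "u holomorphic_on ball 0 1" and pos: "\<And>z. norm z < 1 \<Longrightarrow> 0 \<le> Re (u z)"
    and w: "norm w = 1"
    and small: "\<And>\<epsilon>. \<epsilon> > 0 \<Longrightarrow> \<exists>a. norm a < 1 \<and> Re (u a) * (norm (w - a))\<^sup>2 \<le> \<epsilon> * (1 - (norm a)\<^sup>2)"
  shows "nontangential_limit (\<lambda>z. u z * (w - z)) w 0"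
  unfolding nontangential_limit_def
proof (intro allI impI tendstoI)
  fix k e :: real assume k: "k > 1" and e: "e > 0"
  \<comment> \<open>Chosen so that the constant \<open>16 * k * \<epsilon>\<close> produced below
    equals \<open>e / 2\<close>; the other half of \<open>e\<close> absorbs the cross term
    \<open>2 * |u a| * |w - z|\<close>.\<close>
  define \<epsilon> where "\<epsilon> = e / (32 * k)"
  have \<epsilon>: "\<epsilon> > 0" using k e by (simp add: \<epsilon>_def)
  obtain a where a: "norm a < 1" "Re (u a) * (norm (w - a))\<^sup>2 \<le> \<epsilon> * (1 - (norm a)\<^sup>2)"
    using small[OF \<epsilon>] by blast
  let ?F = "at w within stolz_region k w"
  have wa: "norm (w - a) > 0" using w a(1) by auto
  have lim: "((\<lambda>z. z) \<longlongrightarrow> w) ?F" by (rule tendsto_ident_at)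
  have "((\<lambda>z. norm (1 - cnj a * z)) \<longlongrightarrow> norm (1 - cnj a * w)) ?F"
    by (intro tendsto_intros lim)
  moreover have "norm (1 - cnj a * w) = norm (w - a)"
  proof -
    have "cnj (1 - cnj a * w) = 1 - cnj w * a" by (simp add: mult.commute)
    then show ?thesis
      using norm_one_minus_cnj_unimodular[OF w, of a] by (metis complex_mod_cnj)
  qed
  ultimately have "\<forall>\<^sub>F z in ?F. norm (1 - cnj a * z) < 2 * norm (w - a)"
    using wa by (intro order_tendstoD(2)[where y = "norm (w - a)"]) auto
  moreover have "((\<lambda>z. 2 * norm (u a) * norm (w - z)) \<longlongrightarrow> 2 * norm (u a) * norm (w - w)) ?F"
    by (intro tendsto_intros lim)
  then have "\<forall>\<^sub>F z in ?F. 2 * norm (u a) * norm (w - z) < e / 2"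
    using e by (intro order_tendstoD(2)) auto
  ultimately show "\<forall>\<^sub>F z in ?F. dist (u z * (w - z)) 0 < e"
    using eventually_in_stolz
  proof eventually_elim
    case (elim z)
    note z = stolz_region_bound[OF elim(3) k]
    define y where "y = norm (u z)"
    define m where "m = norm (u a)"
    define d where "d = norm (w - z)"
    have pa: "0 < 1 - (norm a)\<^sup>2" and pz: "0 < 1 - (norm z)\<^sup>2"
      using a z by (simp_all add: power_less_one_iff)
    let ?S = "(norm (u z + cnj (u a)))\<^sup>2"
    \<comment> \<open>The extra factor \<open>|w - a|^2\<close> lets the choice of \<open>a\<close>
      bound \<open>Re (u a)\<close>; afterwards everything depending on \<open>a\<close> except
      \<open>?S\<close> cancels.\<close>
    have "?S * ((1 - (norm a)\<^sup>2) * (1 - (norm z)\<^sup>2)) * (norm (w - a))\<^sup>2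
        \<le> (norm (1 - cnj a * z))\<^sup>2 * (4 * Re (u a) * Re (u z)) * (norm (w - a))\<^sup>2"
      by (intro mult_right_mono Schwarz_Pick_Re_nonneg u pos a z) auto
    also have "\<dots> = 4 * (norm (1 - cnj a * z))\<^sup>2 * Re (u z) * (Re (u a) * (norm (w - a))\<^sup>2)"
      by simp
    also have "\<dots> \<le> 4 * (norm (1 - cnj a * z))\<^sup>2 * Re (u z) * (\<epsilon> * (1 - (norm a)\<^sup>2))"
      using a z pos by (intro mult_left_mono) auto
    also have "\<dots> \<le> 4 * (2 * norm (w - a))\<^sup>2 * y * (\<epsilon> * (1 - (norm a)\<^sup>2))"
      using elim(1) pos[OF z(1)] pa \<epsilon> unfolding y_def
      by (intro mult_mono mult_right_mono power_mono complex_Re_le_cmod mult_nonneg_nonneg) auto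
    finally have "?S * (1 - (norm z)\<^sup>2) * ((1 - (norm a)\<^sup>2) * (norm (w - a))\<^sup>2)
        \<le> 16 * \<epsilon> * y * ((1 - (norm a)\<^sup>2) * (norm (w - a))\<^sup>2)"
      by (simp add: algebra_simps)
    then have S: "?S * (1 - (norm z)\<^sup>2) \<le> 16 * \<epsilon> * y"
      using pa wa by (subst (asm) mult_le_cancel_right) (auto simp: mult_pos_pos not_less)
    \<comment> \<open>The reverse triangle inequality turns the estimate for \<open>?S\<close> into
      one for \<open>y = |u z|\<close>: expanding \<open>(y - m)^2 * d\<close> and dividing by
      \<open>y\<close> bounds \<open>y * d\<close>.\<close>
    have "\<bar>y - m\<bar> \<le> norm (u z + cnj (u a))"
      unfolding y_def m_def
      by (metis complex_mod_cnj norm_minus_cancel norm_triangle_ineq3 diff_minus_eq_add)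
    then have "(y - m)\<^sup>2 \<le> ?S"
      by (metis abs_le_square_iff abs_norm_cancel)
    then have "(y - m)\<^sup>2 * d \<le> ?S * (k * (1 - (norm z)\<^sup>2))"
      using z(2) unfolding d_def by (intro mult_mono) auto
    also have "\<dots> = k * (?S * (1 - (norm z)\<^sup>2))" by simp
    also have "\<dots> \<le> k * (16 * \<epsilon> * y)" using S k by (intro mult_left_mono) auto
    also have "\<dots> = e / 2 * y" using k by (simp add: \<epsilon>_def)
    finally have "y * y * d + m * m * d \<le> y * (e / 2 + 2 * m * d)"
      by (simp add: power2_eq_square algebra_simps)
    moreover have "0 \<le> m * m * d" unfolding m_def d_def by simp
    ultimately have "y * (y * d) \<le> y * (e / 2 + 2 * m * d)" by (simp add: mult.assoc)
    then have "y * d < e"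
    proof (cases "y = 0")
      case False
      then have "y > 0" by (simp add: y_def)
      with \<open>y * (y * d) \<le> _\<close> have "y * d \<le> e / 2 + 2 * m * d" by simp
      then show ?thesis using elim(2) unfolding m_def d_def by linarith
    qed (use e in auto)
    then show ?case by (simp add: y_def d_def norm_mult)
  qed
qed

text \<open>The right side is the Poisson kernel at \<open>w\<close>. Wolff's inequality thus
  compares the real parts of the Cayley transforms of \<open>f z\<close> and
  \<open>z\<close>.\<close>

lemma Re_cayley:
  assumes "norm w = 1"
  shows "Re ((w + z) / (w - z)) = (1 - (norm z)\<^sup>2) / (norm (w - z))\<^sup>2"
proof -
  have "(w + z) / (w - z) = (w + z) * cnj (w - z) / of_real ((norm (w - z))\<^sup>2)"
    by (simp add: complex_div_cnj[of "w + z"])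
  then have "Re ((w + z) / (w - z)) = Re ((w + z) * cnj (w - z)) / (norm (w - z))\<^sup>2"
    by (simp only: Re_divide_of_real)
  also have "Re ((w + z) * cnj (w - z)) = (norm w)\<^sup>2 - (norm z)\<^sup>2"
    by (simp only: cmod_power2) (simp add: algebra_simps power2_eq_square)
  finally show ?thesis using assms by simp
qed

text \<open>Write \<open>F\<close> and \<open>K\<close> for the Cayley transforms of
  \<open>f z\<close> and \<open>z\<close>, so that \<open>Re K \<le> Re F\<close>. Subtracting the
  largest admissible multiple \<open>c * K\<close> from \<open>F\<close> leaves a function that is
  negligible against \<open>1 / (w - z)\<close> nontangentially, and this gives the angular
  derivative \<open>1 / c\<close>.\<close>

lemma wolff_ineq_imp_denjoy_wolff_point:
  assumes f: "f holomorphic_on ball 0 1" and fD: "f ` ball 0 1 \<subseteq> cball 0 1"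
    and w: "norm w = 1" and W: "wolff_ineq f w"
  shows "denjoy_wolff_point f w"
proof (cases "\<exists>z\<in>ball 0 1. f z = w")
  case True
  then obtain p where p: "norm p < 1" "f p = w" by auto
  have "f constant_on ball 0 1"
    by (rule maximum_modulus_principle[OF f, where U = "ball 0 1" and \<xi> = p])
      (use fD p w in \<open>simp_all add: image_subset_iff\<close>)
  then have fw: "f z = w" if "norm z < 1" for z
    using p that unfolding constant_on_def by (metis mem_ball_0)
  have ev: "\<forall>\<^sub>F z in at w within stolz_region k w. f z = w" for k
    using eventually_in_stolz by (rule eventually_mono) (simp add: stolz_region_def fw)
  have "nontangential_limit f w w"
    unfolding nontangential_limit_def using ev tendsto_eventually by blast
  moreover have "((\<lambda>z. (f z - w) / (z - w)) \<longlongrightarrow> 0) (at w within stolz_region k w)" for k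
    by (intro tendsto_eventually eventually_mono[OF ev]) simp
  then have "nontangential_limit (\<lambda>z. (f z - w) / (z - w)) w (of_real 0)"
    unfolding nontangential_limit_def by simp
  ultimately show ?thesis
    unfolding denjoy_wolff_point_def using f fD w by (metis zero_le_one)
next
  case False
  then have fw: "f z \<noteq> w" if "norm z < 1" for z using that by auto
  have zw: "z \<noteq> w" if "norm z < 1" for z using that w by auto
  have fle: "norm (f z) \<le> 1" if "norm z < 1" for z
    using fD that by (simp add: image_subset_iff)
  define F where "F = (\<lambda>z. (w + f z) / (w - f z))"
  define K where "K = (\<lambda>z. (w + z) / (w - z))"
  have ReF: "Re (F z) = (1 - (norm (f z))\<^sup>2) / (norm (w - f z))\<^sup>2" if "norm z < 1" for z
    unfolding F_def using w by (rule Re_cayley)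
  have ReK: "Re (K z) = (1 - (norm z)\<^sup>2) / (norm (w - z))\<^sup>2" if "norm z < 1" for z
    unfolding K_def using w by (rule Re_cayley)
  have Kpos: "Re (K z) > 0" if "norm z < 1" for z
    using that zw[OF that] by (simp add: ReK power_less_one_iff)
  have Wz: "(norm (w - f z))\<^sup>2 * (1 - (norm z)\<^sup>2) \<le> (norm (w - z))\<^sup>2 * (1 - (norm (f z))\<^sup>2)"
    if "norm z < 1" for z
    using W that by (simp add: wolff_ineq_def norm_one_minus_cnj_unimodular[OF w])
  have KF: "Re (K z) \<le> Re (F z)" if "norm z < 1" for z
    using Wz[OF that] fw[OF that] zw[OF that]
    unfolding ReF[OF that] ReK[OF that] by (simp add: divide_simps mult.commute)
  define Q where "Q = (\<lambda>z. Re (F z) / Re (K z))"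
  \<comment> \<open>The largest \<open>c\<close> with \<open>c * Re K \<le> Re F\<close>. Being an
    infimum, it makes the Poisson quotient of \<open>F - c * K\<close> arbitrarily small, as
    \<open>nontangential_limit_zero\<close> demands.\<close>
  define c where "c = (INF z\<in>ball 0 1. Q z)"
  have Q1: "1 \<le> Q z" if "z \<in> ball 0 1" for z
    using KF Kpos that by (simp add: Q_def)
  then have bdd: "bdd_below (Q ` ball 0 1)" by (intro bdd_belowI2)
  have c1: "1 \<le> c" unfolding c_def using Q1 by (intro cINF_greatest) auto
  have cQ: "c \<le> Q z" if "z \<in> ball 0 1" for z
    unfolding c_def using bdd that by (rule cINF_lower)
  have "nontangential_limit (\<lambda>z. (F z - of_real c * K z) * (w - z)) w 0"
  proof (rule nontangential_limit_zero[OF _ _ w])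
    show "(\<lambda>z. F z - of_real c * K z) holomorphic_on ball 0 1"
      unfolding F_def K_def by (intro holomorphic_intros f) (use fw zw in auto)
    show "0 \<le> Re (F z - of_real c * K z)" if "norm z < 1" for z
      using cQ[of z] Kpos[OF that] that by (simp add: Q_def field_simps)
    show "\<exists>a. norm a < 1 \<and> Re (F a - of_real c * K a) * (norm (w - a))\<^sup>2 \<le> \<epsilon> * (1 - (norm a)\<^sup>2)"
      if "\<epsilon> > 0" for \<epsilon>
    proof -
      have "\<exists>a\<in>ball 0 1. Q a < c + \<epsilon>"
        using cInf_lessD[of "Q ` ball 0 1" "c + \<epsilon>"] that unfolding c_def by auto
      then obtain a where a: "norm a < 1" "Q a < c + \<epsilon>" by auto
      then have "Re (F a) < (c + \<epsilon>) * Re (K a)"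
        using Kpos[OF a(1)] by (simp add: Q_def divide_less_eq)
      then have "Re (F a - of_real c * K a) \<le> \<epsilon> * Re (K a)" by (simp add: algebra_simps)
      then have "Re (F a - of_real c * K a) * (norm (w - a))\<^sup>2 \<le> \<epsilon> * Re (K a) * (norm (w - a))\<^sup>2"
        by (rule mult_right_mono) simp
      also have "\<dots> = \<epsilon> * (1 - (norm a)\<^sup>2)" using zw[OF a(1)] by (simp add: ReK[OF a(1)])
      finally show ?thesis using a(1) by blast
    qed
  qed
  then have lim0: "((\<lambda>z. (F z - of_real c * K z) * (w - z)) \<longlongrightarrow> 0) (at w within stolz_region k w)"
    if "k > 1" for k
    using that unfolding nontangential_limit_def by blast
  have limf: "(f \<longlongrightarrow> w) (at w within stolz_region k w)" if k: "k > 1" for k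
  proof -
    \<comment> \<open>Wolff's inequality with \<open>1 - |f z|^2 \<le> 2 |w - f z|\<close> gives a
      Lipschitz bound at \<open>w\<close> inside each Stolz region.\<close>
    have le: "\<forall>\<^sub>F z in at w within stolz_region k w. norm (f z - w) \<le> 2 * k * norm (w - z)"
      using eventually_in_stolz
    proof eventually_elim
      case (elim z)
      note z = stolz_region_bound[OF elim k]
      define x where "x = norm (w - f z)"
      have x: "x > 0" using fw[OF z(1)] by (simp add: x_def)
      have "1 - norm (f z) \<le> x"
        unfolding x_def using norm_triangle_ineq2[of w "f z"] w by simp
      then have "(1 - norm (f z)) * (1 + norm (f z)) \<le> x * 2"
        using fle[OF z(1)] x by (intro mult_mono) auto
      then have fx: "1 - (norm (f z))\<^sup>2 \<le> 2 * x" by (simp add: power2_eq_square algebra_simps)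
      have "x\<^sup>2 * norm (w - z) \<le> x\<^sup>2 * (k * (1 - (norm z)\<^sup>2))"
        using z(2) by (intro mult_left_mono) auto
      also have "\<dots> = k * (x\<^sup>2 * (1 - (norm z)\<^sup>2))" by simp
      also have "\<dots> \<le> k * ((norm (w - z))\<^sup>2 * (1 - (norm (f z))\<^sup>2))"
        using k Wz[OF z(1)] unfolding x_def by (intro mult_left_mono) auto
      also have "\<dots> \<le> k * ((norm (w - z))\<^sup>2 * (2 * x))"
        using k fx by (intro mult_left_mono) auto
      finally have "x * (x * norm (w - z)) \<le> (2 * k * norm (w - z)) * (x * norm (w - z))"
        by (simp add: power2_eq_square algebra_simps)
      moreover have "x * norm (w - z) > 0" using x zw[OF z(1)] by simp
      ultimately have "x \<le> 2 * k * norm (w - z)" by (simp add: mult_le_cancel_right)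
      then show ?case by (simp add: x_def norm_minus_commute)
    qed
    have "((\<lambda>z. 2 * k * norm (w - z)) \<longlongrightarrow> 2 * k * norm (w - w)) (at w within stolz_region k w)"
      by (intro tendsto_intros)
    then have "((\<lambda>z. 2 * k * norm (w - z)) \<longlongrightarrow> 0) (at w within stolz_region k w)"
      by simp
    with le have "((\<lambda>z. f z - w) \<longlongrightarrow> 0) (at w within stolz_region k w)"
      by (rule Lim_null_comparison)
    then show ?thesis by (simp add: LIM_zero_iff)
  qed
  have limq: "((\<lambda>z. (f z - w) / (z - w)) \<longlongrightarrow> of_real (1 / c)) (at w within stolz_region k w)"
    if k: "k > 1" for k
  proof -
    let ?A = "at w within stolz_region k w"
    have w0: "w \<noteq> 0" using w by auto
    \<comment> \<open>As \<open>K z * (w - z) = w + z\<close>, this says that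
      \<open>F z * (w - z)\<close> tends to \<open>2 * c * w\<close>. The difference quotient is
      \<open>w + f z\<close> divided by it.\<close>
    have "((\<lambda>z. (F z - of_real c * K z) * (w - z) + of_real c * (w + z)) \<longlongrightarrow> 0 + of_real c * (w + w)) ?A"
      by (rule tendsto_add[OF lim0[OF k]]) (intro tendsto_intros)
    moreover have "\<forall>\<^sub>F z in ?A. (F z - of_real c * K z) * (w - z) + of_real c * (w + z) = F z * (w - z)"
      using eventually_in_stolz
    proof eventually_elim
      case (elim z)
      have K: "K z * (w - z) = w + z"
        using zw[OF stolz_region_bound(1)[OF elim k]] by (simp add: K_def)
      show ?case unfolding K[symmetric] by (simp add: algebra_simps)
    qed
    ultimately have "((\<lambda>z. F z * (w - z)) \<longlongrightarrow> of_real c * (w + w)) ?A"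
      by (simp add: tendsto_cong)
    then have "((\<lambda>z. (w + f z) / (F z * (w - z))) \<longlongrightarrow> (w + w) / (of_real c * (w + w))) ?A"
      by (intro tendsto_divide tendsto_add tendsto_const limf k) (use c1 w0 in auto)
    \<comment> \<open>Where \<open>w + f z = 0\<close>, also \<open>F z = 0\<close>, and the default
      value of division by zero would falsify the next identity.\<close>
    moreover have "\<forall>\<^sub>F z in ?A. w + f z \<noteq> 0"
      using w0 by (intro tendsto_imp_eventually_ne[where c = "w + w"] tendsto_intros limf k) auto
    then have "\<forall>\<^sub>F z in ?A. (w + f z) / (F z * (w - z)) = (f z - w) / (z - w)"
      using eventually_in_stolz
    proof eventually_elim
      case (elim z)
      have "w - f z \<noteq> 0" "w - z \<noteq> 0"
        using fw zw stolz_region_bound(1)[OF elim(2) k] by auto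
      moreover have "(f z - w) / (z - w) = (w - f z) / (w - z)"
        by (metis minus_diff_eq minus_divide_divide)
      ultimately show ?case using elim(1) by (simp add: F_def)
    qed
    ultimately have "((\<lambda>z. (f z - w) / (z - w)) \<longlongrightarrow> (w + w) / (of_real c * (w + w))) ?A"
      by (simp add: tendsto_cong)
    moreover have "(w + w) / (of_real c * (w + w)) = of_real (1 / c)"
      using w0 by (simp add: divide_simps)
    ultimately show ?thesis by simp
  qed
  have "1 / c \<le> 1" using c1 by simp
  then show ?thesis
    unfolding denjoy_wolff_point_def nontangential_limit_def
    using f fD w limf limq by blast
qed

section \<open>From the angular derivative back to Wolff's inequality\<close>

lemma nontangential_limit_radial:
  assumes "nontangential_limit f w L" "norm w = 1"
  shows "((\<lambda>r. f (of_real r * w)) \<longlongrightarrow> L) (at_left 1)"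
proof -
  \<comment> \<open>The radius satisfies \<open>|r w - w| = 1 - r\<close>, so it lies in the region
    of aperture 2.\<close>
  have "filterlim (\<lambda>r. of_real r * w) (at w within stolz_region 2 w) (at_left 1)"
    unfolding filterlim_at
  proof
    have "\<forall>\<^sub>F r in at_left 1. r \<in> {0<..<1::real}"
      by (rule eventually_at_left_real) simp
    then show "\<forall>\<^sub>F r in at_left 1. of_real r * w \<in> stolz_region 2 w \<and> of_real r * w \<noteq> w"
    proof eventually_elim
      case (elim r)
      have "norm (of_real r * w - w) = norm (of_real (r - 1) * w)" by (simp add: algebra_simps)
      also have "\<dots> = 1 - r"
        using elim assms(2) unfolding norm_mult norm_of_real by simp
      finally show ?case
        using elim assms(2) by (auto simp: stolz_region_def norm_mult)
    qed
    have "((\<lambda>r. of_real r * w) \<longlongrightarrow> of_real 1 * w) (at_left 1)"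
      by (intro tendsto_intros)
    then show "((\<lambda>r. of_real r * w) \<longlongrightarrow> w) (at_left 1)" by simp
  qed
  moreover have "(f \<longlongrightarrow> L) (at w within stolz_region 2 w)"
    using assms(1) unfolding nontangential_limit_def by auto
  ultimately show ?thesis by (rule filterlim_compose[rotated])
qed

text \<open>In the boundary case, Schwarz-Pick is applied with base point \<open>r * w\<close>,
  divided by \<open>1 - r^2\<close>, and r tends to 1. The quotient
  \<open>(1 - |f (r w)|^2) / (1 - r^2)\<close> is controlled by the difference quotient, whose limit
  is \<open>c \<le> 1\<close>.\<close>

lemma denjoy_wolff_point_imp_wolff_ineq:
  assumes DW: "denjoy_wolff_point f w"
  shows "norm w \<le> 1 \<and> wolff_ineq f w"
proof (cases "norm w < 1 \<and> f w = w")
  case True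
  then show ?thesis
    using DW wolff_ineq_interior_iff[of f w] by (simp add: denjoy_wolff_point_def)
next
  case False
  then obtain c :: real where f: "f holomorphic_on ball 0 1" and fD: "f ` ball 0 1 \<subseteq> cball 0 1"
    and w: "norm w = 1" and L: "nontangential_limit f w w" and c: "c \<le> 1"
    and D: "nontangential_limit (\<lambda>z. (f z - w) / (z - w)) w (of_real c)"
    using DW unfolding denjoy_wolff_point_def by blast
  note L = nontangential_limit_radial[OF L w] and D = nontangential_limit_radial[OF D w]
  have ev: "\<forall>\<^sub>F r in at_left 1. r \<in> {0<..<1::real}"
    by (rule eventually_at_left_real) simp
  have fle: "norm (f z) \<le> 1" if "norm z < 1" for z
    using fD that by (simp add: image_subset_iff)
  have rw: "norm (of_real r * w) < 1" if "r \<in> {0<..<1::real}" for r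
    using that w by (simp add: norm_mult)
  have ww: "w * cnj w = 1" using w by (simp add: complex_norm_square[symmetric])
  have w0: "w \<noteq> 0" using w by auto
  define q where "q = (\<lambda>r::real. (f (of_real r * w) - w) / (of_real r * w - w))"
  have q_eq: "q r = (1 - cnj w * f (of_real r * w)) / of_real (1 - r)" if "r < 1" for r
  proof -
    have "(1 - cnj w * x) * w = w - x" for x
      using ww by (simp add: algebra_simps)
    then have 1: "f (of_real r * w) - w = (1 - cnj w * f (of_real r * w)) * (- w)"
      by (metis minus_diff_eq mult_minus_right)
    have 2: "of_real r * w - w = of_real (1 - r) * (- w)" by (simp add: algebra_simps)
    show ?thesis
      unfolding q_def 1 2 using w0 by (intro mult_divide_mult_cancel_right) simp
  qed
  \<comment> \<open>The definition bounds \<open>c\<close> only from above; nonnegativity is needed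
    for \<open>|c| = c\<close> in the limit.\<close>
  have "0 \<le> Re (q r)" if "r \<in> {0<..<1}" for r
  proof -
    have "Re (cnj w * f (of_real r * w)) \<le> norm (cnj w * f (of_real r * w))"
      by (rule complex_Re_le_cmod)
    also have "\<dots> \<le> 1" using w fle[OF rw[OF that]] by (simp add: norm_mult)
    finally show ?thesis
      using that by (simp only: q_eq Re_divide_of_real greaterThanLessThan_iff) simp
  qed
  then have ev0: "\<forall>\<^sub>F r in at_left 1. 0 \<le> Re (q r)"
    using ev by (auto elim: eventually_mono)
  have "((\<lambda>r. Re (q r)) \<longlongrightarrow> Re (of_real c)) (at_left 1)"
    unfolding q_def by (intro tendsto_intros D)
  then have c0: "0 \<le> c"
    using tendsto_lowerbound[OF _ ev0] by fastforce
  have "wolff_ineq f w"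
    unfolding wolff_ineq_def
  proof
    fix z :: complex assume "z \<in> ball 0 1"
    then have z: "norm z < 1" by simp
    let ?l = "\<lambda>r. (norm (1 - cnj (f (of_real r * w)) * f z))\<^sup>2 * (1 - (norm z)\<^sup>2)"
    \<comment> \<open>The factor with \<open>norm (q r)\<close> bounds
      \<open>(1 - |f (r w)|^2) / (1 - r^2)\<close> and tends to \<open>|c|\<close>.\<close>
    let ?r = "\<lambda>r. (norm (1 - cnj (of_real r * w) * z))\<^sup>2 *
      (norm (q r) * ((1 + norm (f (of_real r * w))) / (1 + r)) * (1 - (norm (f z))\<^sup>2))"
    have "\<forall>\<^sub>F r in at_left 1. ?l r \<le> ?r r"
      using ev
    proof eventually_elim
      case (elim r)
      let ?a = "of_real r * w"
      have r: "0 < r" "r < 1" using elim by auto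
      have na: "norm ?a = r" using r w by (simp add: norm_mult)
      have r2: "1 - r\<^sup>2 = (1 - r) * (1 + r)" by (simp add: power2_eq_square algebra_simps)
      have "1 - norm (f ?a) \<le> norm (1 - cnj w * f ?a)"
        using norm_triangle_ineq2[of 1 "cnj w * f ?a"] w by (simp add: norm_mult)
      also have "\<dots> = norm (q r) * (1 - r)"
        using r unfolding q_eq[OF r(2)] norm_divide norm_of_real by simp
      finally have "(1 - norm (f ?a)) * (1 + norm (f ?a)) \<le> norm (q r) * (1 - r) * (1 + norm (f ?a))"
        by (intro mult_right_mono) auto
      then have "1 - (norm (f ?a))\<^sup>2 \<le> norm (q r) * (1 - r) * (1 + norm (f ?a))"
        by (simp add: power2_eq_square algebra_simps)
      also have "\<dots> = norm (q r) * ((1 + norm (f ?a)) / (1 + r)) * (1 - r\<^sup>2)"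
        using r unfolding r2 by simp
      finally have *: "1 - (norm (f ?a))\<^sup>2 \<le> norm (q r) * ((1 + norm (f ?a)) / (1 + r)) * (1 - r\<^sup>2)" .
      have "?l r * (1 - r\<^sup>2) \<le> (norm (1 - cnj ?a * z))\<^sup>2 * ((1 - (norm (f ?a))\<^sup>2) * (1 - (norm (f z))\<^sup>2))"
        using Schwarz_Pick[OF f fD rw[OF elim] z] unfolding na by (simp add: mult_ac)
      also have "\<dots> \<le> (norm (1 - cnj ?a * z))\<^sup>2 *
          (norm (q r) * ((1 + norm (f ?a)) / (1 + r)) * (1 - r\<^sup>2) * (1 - (norm (f z))\<^sup>2))"
        using fle[OF z] by (intro mult_left_mono mult_right_mono *) (auto simp: power_le_one)
      also have "\<dots> = ?r r * (1 - r\<^sup>2)" by simp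
      finally show ?case
        using r by (subst (asm) mult_le_cancel_right) (auto simp: power_less_one_iff not_less abs_square_less_1)
    qed
    moreover have "(?l \<longlongrightarrow> (norm (1 - cnj w * f z))\<^sup>2 * (1 - (norm z)\<^sup>2)) (at_left 1)"
      by (intro tendsto_intros L)
    moreover have "(?r \<longlongrightarrow> (norm (1 - cnj (of_real 1 * w) * z))\<^sup>2 *
        (norm (complex_of_real c) * ((1 + norm w) / (1 + 1)) * (1 - (norm (f z))\<^sup>2))) (at_left 1)"
      unfolding q_def by (intro tendsto_intros L D) auto
    ultimately have "(norm (1 - cnj w * f z))\<^sup>2 * (1 - (norm z)\<^sup>2)
        \<le> (norm (1 - cnj (of_real 1 * w) * z))\<^sup>2 *
        (norm (complex_of_real c) * ((1 + norm w) / (1 + 1)) * (1 - (norm (f z))\<^sup>2))"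
      by (intro tendsto_le[of "at_left 1"]) auto
    also have "\<dots> = (norm (1 - cnj w * z))\<^sup>2 * (c * (1 - (norm (f z))\<^sup>2))"
      using w c0 by simp
    also have "\<dots> \<le> (norm (1 - cnj w * z))\<^sup>2 * (1 - (norm (f z))\<^sup>2)"
      using c0 c fle[OF z] by (intro mult_left_mono mult_left_le_one_le) (auto simp: power_le_one)
    finally show "(norm (1 - cnj w * f z))\<^sup>2 * (1 - (norm z)\<^sup>2)
        \<le> (norm (1 - cnj w * z))\<^sup>2 * (1 - (norm (f z))\<^sup>2)" .
  qed
  then show ?thesis using w by simp
qed

lemma denjoy_wolff_point_iff_wolff_ineq:
  assumes f: "f holomorphic_on ball 0 1" and fD: "f ` ball 0 1 \<subseteq> cball 0 1"
  shows "denjoy_wolff_point f w \<longleftrightarrow> norm w \<le> 1 \<and> wolff_ineq f w"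
proof
  assume "norm w \<le> 1 \<and> wolff_ineq f w"
  then consider "norm w < 1" "f w = w" | "norm w = 1" "wolff_ineq f w"
    using wolff_ineq_interior_iff[OF f fD] by fastforce
  then show "denjoy_wolff_point f w"
    using wolff_ineq_imp_denjoy_wolff_point[OF f fD] f fD
    by cases (auto simp: denjoy_wolff_point_def)
qed (rule denjoy_wolff_point_imp_wolff_ineq)

section \<open>Denjoy-Wolff points of the maps \<open>\<alpha> h\<close>\<close>

locale disc_multiplier =
  fixes h :: "complex \<Rightarrow> complex"
  assumes holo: "h holomorphic_on ball 0 1" and norm_le: "norm z < 1 \<Longrightarrow> norm (h z) \<le> 1"
    and nonzero: "h 0 \<noteq> 0"
begin

text \<open>Unlike the fixed-point equation, Wolff's inequality also makes sense for
  \<open>w\<close> on the circle, so one description serves the whole closed disc.\<close>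

definition \<omega> :: "complex \<Rightarrow> complex" where
  "\<omega> \<alpha> = (THE w. norm w \<le> 1 \<and> wolff_ineq (\<lambda>z. \<alpha> * h z) w)"

lemma mult_holo: "(\<lambda>z. \<alpha> * h z) holomorphic_on ball 0 1"
  by (intro holomorphic_intros holo)

lemma mult_norm_le:
  assumes "norm z < 1"
  shows "norm (\<alpha> * h z) \<le> norm \<alpha>"
  using norm_le[OF assms] by (simp add: norm_mult mult_left_le)

lemma mult_disc:
  assumes "norm \<alpha> \<le> 1"
  shows "(\<lambda>z. \<alpha> * h z) ` ball 0 1 \<subseteq> cball 0 1"
  using order_trans[OF mult_norm_le assms] by auto

lemma mult_not_id: "\<exists>z\<in>ball 0 1. \<alpha> * h z \<noteq> z"
proof (cases "\<alpha> = 0")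
  case True
  then show ?thesis by (intro bexI[of _ "1/2"]) auto
next
  case False
  then show ?thesis using nonzero by (intro bexI[of _ 0]) auto
qed

section \<open>Existence, uniqueness and continuous dependence of the Wolff point\<close>

lemma fixed_point_exists:
  assumes "norm \<alpha> < 1"
  shows "\<exists>z. norm z < 1 \<and> \<alpha> * h z = z"
proof -
  obtain z where z: "z \<in> cball 0 (norm \<alpha>)" "\<alpha> * h z = z"
  \<comment> \<open>Since \<open>|h| \<le> 1\<close>, the map \<open>\<alpha> * h\<close> sends the
    closed disc of radius \<open>|\<alpha>|\<close>, a compact subset of the open unit disc, into
    itself.\<close>
  proof (rule brouwer[of "cball 0 (norm \<alpha>)" "\<lambda>z. \<alpha> * h z"])
    show "continuous_on (cball 0 (norm \<alpha>)) (\<lambda>z. \<alpha> * h z)"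
      using assms by (intro holomorphic_on_imp_continuous_on holomorphic_on_subset[OF mult_holo]) auto
    show "(\<lambda>z. \<alpha> * h z) \<in> cball 0 (norm \<alpha>) \<rightarrow> cball 0 (norm \<alpha>)"
      using mult_norm_le[of _ \<alpha>] assms by auto
  qed auto
  then show ?thesis using assms by (intro exI[of _ z]) auto
qed

definition wolff_graph :: "(complex \<times> complex) set" where
  "wolff_graph = {p \<in> cball 0 1 \<times> cball 0 1. wolff_ineq (\<lambda>z. fst p * h z) (snd p)}"

lemma closed_wolff_graph: "closed wolff_graph"
proof -
  have "wolff_graph = (cball 0 1 \<times> cball 0 1) \<inter> (\<Inter>z\<in>ball 0 1. {p.
      (norm (1 - cnj (snd p) * (fst p * h z)))\<^sup>2 * (1 - (norm z)\<^sup>2)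
      \<le> (norm (1 - cnj (snd p) * z))\<^sup>2 * (1 - (norm (fst p * h z))\<^sup>2)})"
    unfolding wolff_graph_def wolff_ineq_def by auto
  also have "closed \<dots>"
    by (intro closed_Int closed_Times closed_cball closed_INT ballI closed_Collect_le continuous_intros)
  finally show ?thesis .
qed

text \<open>For \<open>norm \<alpha> = 1\<close> existence follows by compactness from the case \<open>norm \<alpha> < 1\<close>.\<close>

lemma wolff_point_exists:
  assumes "norm \<alpha> \<le> 1"
  shows "\<exists>w. norm w \<le> 1 \<and> wolff_ineq (\<lambda>z. \<alpha> * h z) w"
proof -
  have "bounded wolff_graph"
    by (rule bounded_subset[of "cball 0 1 \<times> cball 0 1"]) (auto simp: wolff_graph_def intro: bounded_Times)
  then have "compact wolff_graph" using closed_wolff_graph by (simp add: compact_eq_bounded_closed)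
  then have "closed (fst ` wolff_graph)"
    by (intro compact_imp_closed compact_continuous_image continuous_intros)
  \<comment> \<open>The projection of the compact graph is closed; once it contains the open disc,
    it contains the closed one.\<close>
  moreover have "ball 0 1 \<subseteq> fst ` wolff_graph"
  proof
    fix \<beta> :: complex assume "\<beta> \<in> ball 0 1"
    then have \<beta>: "norm \<beta> < 1" by simp
    then obtain z where z: "norm z < 1" "\<beta> * h z = z" using fixed_point_exists by blast
    then have "wolff_ineq (\<lambda>z. \<beta> * h z) z"
      using wolff_ineq_interior_iff[OF mult_holo mult_disc] \<beta> by simp
    then have "(\<beta>, z) \<in> wolff_graph" using \<beta> z by (simp add: wolff_graph_def)
    then show "\<beta> \<in> fst ` wolff_graph" by force
  qed
  ultimately have "closure (ball 0 1) \<subseteq> fst ` wolff_graph" by (rule closure_minimal[rotated])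
  then have "\<alpha> \<in> fst ` wolff_graph" using assms by auto
  then show ?thesis by (auto simp: wolff_graph_def)
qed

lemma \<omega>_unique:
  assumes "norm \<alpha> \<le> 1"
  shows "norm w \<le> 1 \<and> wolff_ineq (\<lambda>z. \<alpha> * h z) w \<longleftrightarrow> w = \<omega> \<alpha>"
proof -
  have "\<exists>!w. norm w \<le> 1 \<and> wolff_ineq (\<lambda>z. \<alpha> * h z) w"
    using wolff_point_exists[OF assms]
      wolff_ineq_unique[OF mult_holo mult_disc[OF assms] mult_not_id] by blast
  then show ?thesis unfolding \<omega>_def by (metis (mono_tags, lifting) theI')
qed

lemma \<omega>_props:
  assumes "norm \<alpha> \<le> 1"
  shows "norm (\<omega> \<alpha>) \<le> 1" "wolff_ineq (\<lambda>z. \<alpha> * h z) (\<omega> \<alpha>)"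
  using \<omega>_unique[OF assms, of "\<omega> \<alpha>"] by simp_all

lemma fixed_point_iff:
  assumes "norm \<alpha> \<le> 1" "norm w < 1"
  shows "\<alpha> * h w = w \<longleftrightarrow> w = \<omega> \<alpha>"
  using \<omega>_unique[OF assms(1), of w] wolff_ineq_interior_iff[OF mult_holo mult_disc[OF assms(1)] assms(2)]
    assms(2) by auto

lemma norm_\<omega>_less:
  assumes "norm \<alpha> < 1"
  shows "norm (\<omega> \<alpha>) < 1"
  using fixed_point_exists[OF assms] fixed_point_iff[of \<alpha>] assms by auto

lemma denjoy_wolff_point_iff_\<omega>:
  assumes "norm \<alpha> \<le> 1"
  shows "denjoy_wolff_point (\<lambda>z. \<alpha> * h z) w \<longleftrightarrow> w = \<omega> \<alpha>"
  using denjoy_wolff_point_iff_wolff_ineq[OF mult_holo mult_disc[OF assms]] \<omega>_unique[OF assms] by simp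

text \<open>By uniqueness the graph of \<open>\<omega>\<close> over the closed disc is exactly
  \<open>wolff_graph\<close>. A closed graph with values in a compact set forces continuity.\<close>

lemma continuous_on_\<omega>: "continuous_on (cball 0 1) \<omega>"
proof (rule continuous_from_closed_graph[of "cball 0 1"])
  show "\<omega> \<in> cball 0 1 \<rightarrow> cball 0 1" using \<omega>_props(1) by auto
  have "(\<lambda>\<alpha>. (\<alpha>, \<omega> \<alpha>)) ` cball 0 1 = wolff_graph"
  proof (intro set_eqI iffI)
    fix p assume "p \<in> (\<lambda>\<alpha>. (\<alpha>, \<omega> \<alpha>)) ` cball 0 1"
    then show "p \<in> wolff_graph" using \<omega>_props by (auto simp: wolff_graph_def)
  next
    fix p assume "p \<in> wolff_graph"
    then have "norm (fst p) \<le> 1" "snd p = \<omega> (fst p)"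
      using \<omega>_unique[of "fst p" "snd p"] by (auto simp: wolff_graph_def)
    then show "p \<in> (\<lambda>\<alpha>. (\<alpha>, \<omega> \<alpha>)) ` cball 0 1" by (intro image_eqI[of _ _ "fst p"]) (auto simp: prod_eq_iff)
  qed
  then show "closed ((\<lambda>\<alpha>. (\<alpha>, \<omega> \<alpha>)) ` cball 0 1)" using closed_wolff_graph by simp
qed auto

section \<open>Injectivity and analytic continuation\<close>

lemma h_\<omega>_nonzero:
  assumes "norm \<alpha> \<le> 1" "norm (\<omega> \<alpha>) < 1"
  shows "h (\<omega> \<alpha>) \<noteq> 0"
  \<comment> \<open>A zero of \<open>h\<close> at the fixed point would place that point at 0, where
    \<open>h\<close> does not vanish.\<close>
  using fixed_point_iff[OF assms] nonzero by (metis mult_zero_right)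

text \<open>At a common interior value \<open>w\<close>, the nonzero factor \<open>h w\<close>
  cancels. At a common boundary value, \<open>\<alpha> * h\<close> and \<open>\<beta> * h\<close>
  both have radial limit \<open>w\<close>; computing the limit of
  \<open>\<alpha> * \<beta> * h\<close> in two ways gives
  \<open>\<beta> * w = \<alpha> * w\<close>.\<close>

lemma inj_on_\<omega>: "inj_on \<omega> (cball 0 1)"
proof (rule inj_onI)
  fix \<alpha> \<beta> :: complex
  assume "\<alpha> \<in> cball 0 1" "\<beta> \<in> cball 0 1" and eq: "\<omega> \<alpha> = \<omega> \<beta>"
  then have \<alpha>: "norm \<alpha> \<le> 1" and \<beta>: "norm \<beta> \<le> 1" by auto
  define w where "w = \<omega> \<alpha>"
  show "\<alpha> = \<beta>"
  proof (cases "norm w < 1")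
    case True
    then have "\<alpha> * h w = \<beta> * h w"
      using fixed_point_iff[OF \<alpha>, of w] fixed_point_iff[OF \<beta>, of w] eq by (simp add: w_def)
    then show ?thesis using h_\<omega>_nonzero[OF \<alpha>] True by (simp add: w_def)
  next
    case False
    then have w: "norm w = 1" using \<omega>_props(1)[OF \<alpha>] by (simp add: w_def)
    have lim: "((\<lambda>r. \<gamma> * h (of_real r * w)) \<longlongrightarrow> w) (at_left 1)"
      if "norm \<gamma> \<le> 1" "w = \<omega> \<gamma>" for \<gamma>
      using denjoy_wolff_point_iff_\<omega>[OF that(1), of w] that(2) w
      by (intro nontangential_limit_radial[where f = "\<lambda>z. \<gamma> * h z"]) (auto simp: denjoy_wolff_point_def)
    have "((\<lambda>r. \<beta> * (\<alpha> * h (of_real r * w))) \<longlongrightarrow> \<beta> * w) (at_left 1)"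
      by (intro tendsto_intros lim \<alpha>) (simp add: w_def)
    moreover have "((\<lambda>r. \<alpha> * (\<beta> * h (of_real r * w))) \<longlongrightarrow> \<alpha> * w) (at_left 1)"
      by (intro tendsto_intros lim \<beta>) (simp add: w_def eq)
    then have "((\<lambda>r. \<beta> * (\<alpha> * h (of_real r * w))) \<longlongrightarrow> \<alpha> * w) (at_left 1)"
      by (simp only: mult.left_commute)
    ultimately have "\<beta> * w = \<alpha> * w" by (intro tendsto_unique[of "at_left (1::real)"]) auto
    then show ?thesis using w by auto
  qed
qed

text \<open>The continuation is the local inverse of \<open>z / h z\<close>; if the latter had a critical point at
  \<open>\<omega> \<alpha>\<close>, then \<open>\<alpha> * h\<close> would have derivative \<open>1\<close> at its fixed point.\<close>

lemma \<omega>_continuation: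
  assumes \<alpha>: "norm \<alpha> \<le> 1" and \<omega>: "norm (\<omega> \<alpha>) < 1"
  shows "\<exists>U g. open U \<and> \<alpha> \<in> U \<and> g holomorphic_on U \<and> (\<forall>z\<in>U \<inter> cball 0 1. g z = \<omega> z)"
proof -
  define w where "w = \<omega> \<alpha>"
  have w: "norm w < 1" "\<alpha> * h w = w" "h w \<noteq> 0"
    using \<omega> fixed_point_iff[OF \<alpha> \<omega>] h_\<omega>_nonzero[OF \<alpha> \<omega>] by (simp_all add: w_def)
  define S where "S = {z \<in> ball 0 1. h z \<noteq> 0}"
  have S: "open S" "w \<in> S"
    using continuous_open_preimage[OF holomorphic_on_imp_continuous_on[OF holo], of "-{0}"] w
    by (auto simp: S_def Int_def vimage_def)
  define P where "P = (\<lambda>z. z / h z)"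
  have holP: "P holomorphic_on S"
    unfolding P_def by (intro holomorphic_intros holomorphic_on_subset[OF holo]) (auto simp: S_def)
  have "deriv P w \<noteq> 0"
  proof
    assume "deriv P w = 0"
    have dh: "(h has_field_derivative deriv h w) (at w)"
      using w by (intro holomorphic_derivI[OF holo]) auto
    then have "(P has_field_derivative (1 * h w - w * deriv h w) / (h w * h w)) (at w)"
      unfolding P_def using w by (intro DERIV_divide DERIV_ident)
    then have "deriv P w = (h w - w * deriv h w) / (h w * h w)" by (simp add: DERIV_imp_deriv)
    then have "h w = w * deriv h w" using w \<open>deriv P w = 0\<close> by simp
    also have "\<dots> = (\<alpha> * deriv h w) * h w" using w(2) by (metis mult.assoc mult.commute)
    finally have "\<alpha> * deriv h w = 1" using w(3) by simp
    then have "deriv (\<lambda>z. \<alpha> * h z) w = 1"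
      using DERIV_cmult[OF dh, of \<alpha>] by (simp add: DERIV_imp_deriv)
    then have "\<alpha> * h z = z" if "norm z < 1" for z
      using disc_map_eq_id[OF mult_holo mult_disc[OF \<alpha>] w(1,2) _ that] by blast
    then show False using mult_not_id[of \<alpha>] by auto
  qed
  then obtain r where r: "r > 0" "ball w r \<subseteq> S" and inj: "inj_on P (ball w r)"
    using has_complex_derivative_locally_injective[OF holP S(2,1)] by blast
  note holP' = holomorphic_on_subset[OF holP r(2)]
  obtain g where g: "g holomorphic_on P ` ball w r" "\<And>z. z \<in> ball w r \<Longrightarrow> g (P z) = z"
    using holomorphic_has_inverse[OF holP' open_ball inj] by metis
  show ?thesis
  proof (intro exI conjI ballI)
    show "open (P ` ball w r)" by (rule open_mapping_thm3[OF holP' open_ball inj])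
    have "P w = \<alpha>" using w by (simp add: P_def divide_eq_eq)
    then show "\<alpha> \<in> P ` ball w r" using r by force
    show "g holomorphic_on P ` ball w r" by (rule g)
    fix z assume "z \<in> P ` ball w r \<inter> cball 0 1"
    then obtain x where x: "x \<in> ball w r" "z = P x" and z: "norm z \<le> 1" by auto
    \<comment> \<open>\<open>z = P x\<close> makes \<open>x\<close> an interior fixed point of
      \<open>z * h\<close>, so uniqueness identifies it with \<open>\<omega> z\<close>, also for
      \<open>z\<close> on the circle.\<close>
    then have "norm x < 1" "z * h x = x" using r by (auto simp: S_def P_def)
    then show "g z = \<omega> z" using fixed_point_iff[OF z, of x] g(2)[OF x(1)] x by simp
  qed
qed

text \<open>Over the open disc the values of \<open>\<omega>\<close> are interior, so the local
  continuation exists at every point and coincides with \<open>\<omega>\<close> nearby.\<close>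

lemma holomorphic_\<omega>: "\<omega> holomorphic_on ball 0 1"
  unfolding holomorphic_on_def
proof
  fix \<alpha> :: complex assume "\<alpha> \<in> ball 0 1"
  then have \<alpha>: "norm \<alpha> < 1" by simp
  then obtain U g where U: "open U" "\<alpha> \<in> U" "g holomorphic_on U"
    and eq: "\<And>z. z \<in> U \<inter> cball 0 1 \<Longrightarrow> g z = \<omega> z"
    using \<omega>_continuation[of \<alpha>] norm_\<omega>_less[OF \<alpha>] by fastforce
  have "g holomorphic_on U \<inter> ball 0 1" using U(3) by (rule holomorphic_on_subset) auto
  then have "\<omega> holomorphic_on U \<inter> ball 0 1"
    by (rule holomorphic_transform) (use eq in auto)
  then show "\<omega> field_differentiable at \<alpha> within ball 0 1"
    using U \<alpha> holomorphic_on_imp_differentiable_at[of \<omega> "U \<inter> ball 0 1" \<alpha>]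
    by (auto intro: field_differentiable_at_within)
qed

end

section \<open>The map \<open>z / \<Phi> z\<close>\<close>

lemma g_map_eq_mult: "g_map \<Phi> \<alpha> z = \<alpha> * g_map \<Phi> 1 z"
  by (simp add: g_map_def)

lemma nicely_meromorphic_punctured_nhd:
  assumes mero: "\<Phi> nicely_meromorphic_on A" and A: "open A" "z0 \<in> A"
  shows "\<exists>r>0. ball z0 r \<subseteq> A \<and> \<Phi> holomorphic_on ball z0 r - {z0} \<and>
    (\<forall>z\<in>ball z0 r - {z0}. \<not> is_pole \<Phi> z)"
proof -
  have "isolated_singularity_at \<Phi> z0"
    using mero A by (meson meromorphic_on_isolated_singularity meromorphic_on_meromorphic_at nicely_meromorphic_on_def)
  then obtain r1 where r1: "r1 > 0" "\<Phi> analytic_on ball z0 r1 - {z0}"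
    unfolding isolated_singularity_at_def by blast
  obtain r2 where r2: "r2 > 0" "ball z0 r2 \<subseteq> A" using A open_contains_ball by blast
  show ?thesis
  proof (intro exI[of _ "min r1 r2"] conjI ballI)
    have sub: "ball z0 (min r1 r2) - {z0} \<subseteq> ball z0 r1 - {z0}" by auto
    show "\<Phi> holomorphic_on ball z0 (min r1 r2) - {z0}"
      using r1(2) sub by (meson analytic_imp_holomorphic holomorphic_on_subset)
    show "\<not> is_pole \<Phi> z" if "z \<in> ball z0 (min r1 r2) - {z0}" for z
      using r1(2) sub that by (meson analytic_at_imp_no_pole analytic_on_analytic_at subsetD)
  qed (use r1 r2 in auto)
qed

context
  fixes \<Phi> :: "complex \<Rightarrow> complex"
  assumes mero: "\<Phi> nicely_meromorphic_on ball 0 1"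
    and zero: "\<not> is_pole \<Phi> 0" "\<Phi> 0 = 0"
    and bound: "\<And>z. norm z < 1 \<Longrightarrow> \<not> is_pole \<Phi> z \<Longrightarrow> norm z \<le> norm (\<Phi> z)"
begin

lemma quotient_tendsto_deriv: "((\<lambda>z. \<Phi> z / z) \<longlongrightarrow> deriv \<Phi> 0) (at 0)"
proof -
  have "\<Phi> analytic_on {0}"
    using nicely_meromorphic_on_imp_analytic_at[OF mero] zero by simp
  then have "(\<Phi> has_field_derivative deriv \<Phi> 0) (at 0)"
    by (metis analytic_on_imp_differentiable_at DERIV_deriv_iff_field_differentiable insertI1)
  then show ?thesis using zero by (simp add: has_field_derivative_iff)
qed

text \<open>The bound on \<open>\<Phi>\<close> passes to the limit of \<open>\<Phi> z / z\<close>.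
  It makes the filled-in value \<open>1 / deriv \<Phi> 0\<close> nonzero and of norm at most
  1.\<close>

lemma one_le_norm_deriv: "1 \<le> norm (deriv \<Phi> 0)"
proof (rule tendsto_lowerbound)
  show "((\<lambda>z. norm (\<Phi> z / z)) \<longlongrightarrow> norm (deriv \<Phi> 0)) (at 0)"
    by (intro tendsto_intros quotient_tendsto_deriv)
  have "(0::complex) \<in> ball 0 1" by simp
  then obtain r where r: "r > 0" "ball 0 r \<subseteq> ball (0::complex) 1" "\<Phi> holomorphic_on ball 0 r - {0}"
    "\<forall>z\<in>ball 0 r - {0}. \<not> is_pole \<Phi> z"
    using nicely_meromorphic_punctured_nhd[OF mero open_ball] by meson
  have "\<forall>\<^sub>F z in at 0. z \<in> ball 0 r - {0::complex}"
    using r(1) by (intro eventually_at_in_open) auto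
  then show "\<forall>\<^sub>F z in at 0. 1 \<le> norm (\<Phi> z / z)"
  proof eventually_elim
    case (elim z)
    then have "norm z \<le> norm (\<Phi> z)" using bound[of z] r by auto
    then show ?case using elim by (simp add: norm_divide)
  qed
qed auto

lemma g_map_one_eq:
  assumes "norm z < 1" "\<not> is_pole \<Phi> z" "z \<noteq> 0"
  shows "g_map \<Phi> 1 z = z / \<Phi> z" "\<Phi> z \<noteq> 0"
  using bound[of z] assms by (auto simp: g_map_def)

text \<open>The values prescribed at 0 and at the poles are the limits of
  \<open>z / \<Phi> z\<close> there: the reciprocal derivative and 0, respectively. Elsewhere the
  bound keeps \<open>\<Phi>\<close> away from 0.\<close>

lemma isCont_g_map_one:
  assumes "norm z0 < 1"
  shows "isCont (g_map \<Phi> 1) z0"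
proof -
  have "z0 \<in> ball 0 1" using assms by simp
  then obtain r where r: "r > 0" "ball z0 r \<subseteq> ball 0 1" "\<Phi> holomorphic_on ball z0 r - {z0}"
    "\<forall>z\<in>ball z0 r - {z0}. \<not> is_pole \<Phi> z"
    using nicely_meromorphic_punctured_nhd[OF mero open_ball] by meson
  have "\<forall>\<^sub>F z in at z0. z \<in> ball z0 r - {z0}"
    using r(1) by (intro eventually_at_in_open) auto
  moreover have "\<forall>\<^sub>F z in at z0. z \<noteq> 0"
    by (rule eventually_neq_at_within)
  ultimately have ev: "\<forall>\<^sub>F z in at z0. z / \<Phi> z = g_map \<Phi> 1 z"
    by eventually_elim (use r g_map_one_eq in auto)
  have "((\<lambda>z. z / \<Phi> z) \<longlongrightarrow> g_map \<Phi> 1 z0) (at z0)"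
  proof -
    consider "z0 = 0" | "z0 \<noteq> 0" "is_pole \<Phi> z0" | "z0 \<noteq> 0" "\<not> is_pole \<Phi> z0" by blast
    then show ?thesis
    proof cases
      case 1
      have "((\<lambda>z. inverse (\<Phi> z / z)) \<longlongrightarrow> inverse (deriv \<Phi> 0)) (at 0)"
        using one_le_norm_deriv by (intro tendsto_inverse quotient_tendsto_deriv) auto
      then show ?thesis using 1 by (simp add: g_map_def divide_inverse mult.commute)
    next
      case 2
      then have "filterlim \<Phi> at_infinity (at z0)" by (simp add: is_pole_def)
      then have "((\<lambda>z. z / \<Phi> z) \<longlongrightarrow> 0) (at z0)"
        by (rule tendsto_divide_0[OF tendsto_ident_at])
      then show ?thesis using 2 by (simp add: g_map_def)
    next
      case 3
      then have "\<Phi> \<midarrow>z0\<rightarrow> \<Phi> z0"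
        using mero assms by (auto simp: nicely_meromorphic_on_def)
      then have "((\<lambda>z. z / \<Phi> z) \<longlongrightarrow> z0 / \<Phi> z0) (at z0)"
        using g_map_one_eq[of z0] 3 assms by (intro tendsto_divide tendsto_ident_at) auto
      then show ?thesis using g_map_one_eq[of z0] 3 assms by simp
    qed
  qed
  then show ?thesis
    unfolding isCont_def using ev by (rule Lim_transform_eventually)
qed

text \<open>Continuity makes the exceptional points removable singularities.\<close>

lemma holomorphic_g_map_one: "g_map \<Phi> 1 holomorphic_on ball 0 1"
  unfolding holomorphic_on_def
proof
  fix z0 :: complex assume "z0 \<in> ball 0 1"
  then obtain r where r: "r > 0" "ball z0 r \<subseteq> ball 0 1" "\<Phi> holomorphic_on ball z0 r - {z0}"
    "\<forall>z\<in>ball z0 r - {z0}. \<not> is_pole \<Phi> z"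
    using nicely_meromorphic_punctured_nhd[OF mero open_ball] by meson
  \<comment> \<open>The origin is excluded as well, since the ball around \<open>z0\<close> may
    contain it and \<open>g_map\<close> is not given by the quotient there.\<close>
  have hol: "g_map \<Phi> 1 holomorphic_on ball z0 r - {0, z0}"
  proof (rule holomorphic_transform)
    show "(\<lambda>z. z / \<Phi> z) holomorphic_on ball z0 r - {0, z0}"
      by (intro holomorphic_intros holomorphic_on_subset[OF r(3)]) (use r g_map_one_eq in auto)
    show "z / \<Phi> z = g_map \<Phi> 1 z" if "z \<in> ball z0 r - {0, z0}" for z
      using r g_map_one_eq[of z] that by auto
  qed
  have lim: "(g_map \<Phi> 1 \<longlongrightarrow> g_map \<Phi> 1 z) (at z within ball z0 r)" if "z \<in> {0, z0} \<inter> ball z0 r" for z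
  proof -
    have "z \<in> ball 0 1" using r(2) that by blast
    then have "norm z < 1" by simp
    then show ?thesis
      using isCont_g_map_one continuous_at_imp_continuous_at_within continuous_within by blast
  qed
  have "ball z0 r - {0, z0} \<inter> ball z0 r = ball z0 r - {0, z0}" by blast
  with hol have "g_map \<Phi> 1 holomorphic_on ball z0 r - {0, z0} \<inter> ball z0 r" by simp
  with lim have "g_map \<Phi> 1 holomorphic_on ball z0 r"
    by (rule no_isolated_singularity') auto
  then have "g_map \<Phi> 1 field_differentiable at z0"
    using r(1) by (intro holomorphic_on_imp_differentiable_at[of _ "ball z0 r"]) auto
  then show "g_map \<Phi> 1 field_differentiable at z0 within ball 0 1"
    by (rule field_differentiable_at_within)
qed

lemma disc_multiplier_g_map: "disc_multiplier (g_map \<Phi> 1)"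
proof
  show "g_map \<Phi> 1 holomorphic_on ball 0 1" by (rule holomorphic_g_map_one)
  have d: "deriv \<Phi> 0 \<noteq> 0" using one_le_norm_deriv by auto
  then show "g_map \<Phi> 1 0 \<noteq> 0" by (simp add: g_map_def)
  show "norm (g_map \<Phi> 1 z) \<le> 1" if "norm z < 1" for z
  proof (cases "z = 0 \<or> is_pole \<Phi> z")
    case True
    then show ?thesis using one_le_norm_deriv d zero by (auto simp: g_map_def norm_divide)
  next
    case False
    then show ?thesis using bound[OF that] g_map_one_eq[OF that] by (simp add: norm_divide)
  qed
qed

text \<open>At a pole the convention \<open>g_map \<Phi> 1 z = 0\<close> leaves the equation
  \<open>0 = z\<close>, which fails because 0 is not a pole. At \<open>z = 0\<close> both sides say
  \<open>\<alpha> = 0\<close>.\<close>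

lemma value_iff_fixed_point:
  assumes "norm z < 1"
  shows "\<not> is_pole \<Phi> z \<and> \<Phi> z = \<alpha> \<longleftrightarrow> \<alpha> * g_map \<Phi> 1 z = z"
proof (cases "z = 0 \<or> is_pole \<Phi> z")
  case True
  have "deriv \<Phi> 0 \<noteq> 0" using one_le_norm_deriv by auto
  then show ?thesis using True zero by (auto simp: g_map_def)
next
  case False
  then have g: "g_map \<Phi> 1 z = z / \<Phi> z" "\<Phi> z \<noteq> 0" using g_map_one_eq[OF assms] by auto
  then show ?thesis unfolding g(1) using False by (auto simp: divide_eq_eq)
qed

end

theorem theorem2p9:
  fixes \<Phi> :: "complex \<Rightarrow> complex"
  assumes mero: "\<Phi> nicely_meromorphic_on ball 0 1"
    and zero: "\<not> is_pole \<Phi> 0 \<and> \<Phi> 0 = 0"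
    and bound: "\<forall>z\<in>ball 0 1. is_pole \<Phi> z \<or> norm (\<Phi> z) \<ge> norm z"
  shows "(\<forall>\<alpha>\<in>ball 0 1. \<exists>!z. z \<in> ball 0 1 \<and> \<not> is_pole \<Phi> z \<and> \<Phi> z = \<alpha>) \<and>
    (\<exists>\<omega> :: complex \<Rightarrow> complex.
       (continuous_on (cball 0 1) \<omega> \<and> \<omega> ` cball 0 1 \<subseteq> cball 0 1 \<and> \<omega> ` ball 0 1 \<subseteq> ball 0 1 \<and>
        \<omega> holomorphic_on ball 0 1 \<and>
        (\<forall>z\<in>ball 0 1. \<not> is_pole \<Phi> (\<omega> z) \<and> \<Phi> (\<omega> z) = z)) \<and>
       (\<forall>\<alpha>\<in>cball 0 1. \<forall>w. denjoy_wolff_point (g_map \<Phi> \<alpha>) w \<longleftrightarrow> w = \<omega> \<alpha>) \<and>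
       inj_on \<omega> (cball 0 1) \<and>
       (\<forall>\<zeta>\<in>sphere 0 1. norm (\<omega> \<zeta>) < 1 \<longrightarrow>
          (\<exists>U h. open U \<and> \<zeta> \<in> U \<and> h holomorphic_on U \<and> (\<forall>z\<in>U \<inter> cball 0 1. h z = \<omega> z))))"
proof -
  have hyps: "\<Phi> nicely_meromorphic_on ball 0 1" "\<not> is_pole \<Phi> 0" "\<Phi> 0 = 0"
    "\<And>z. norm z < 1 \<Longrightarrow> \<not> is_pole \<Phi> z \<Longrightarrow> norm z \<le> norm (\<Phi> z)"
    using mero zero bound by auto
  interpret disc_multiplier "g_map \<Phi> 1" by (rule disc_multiplier_g_map[OF hyps])
  \<comment> \<open>This covers \<open>norm \<alpha> = 1\<close> too, but only for interior
    \<open>z\<close>; for \<open>norm \<alpha> < 1\<close> the point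
    \<open>\<omega> \<alpha>\<close> is interior by \<open>norm_\<omega>_less\<close>.\<close>
  have val: "\<not> is_pole \<Phi> z \<and> \<Phi> z = \<alpha> \<longleftrightarrow> z = \<omega> \<alpha>" if "norm z < 1" "norm \<alpha> \<le> 1" for z \<alpha>
    using value_iff_fixed_point[OF hyps that(1)] fixed_point_iff[OF that(2,1)] by simp
  have g: "g_map \<Phi> \<alpha> = (\<lambda>z. \<alpha> * g_map \<Phi> 1 z)" for \<alpha>
    by (rule ext) (rule g_map_eq_mult)
  show ?thesis
  proof (intro conjI exI[of _ \<omega>] ballI allI impI)
    show "\<exists>!z. z \<in> ball 0 1 \<and> \<not> is_pole \<Phi> z \<and> \<Phi> z = \<alpha>" if "\<alpha> \<in> ball 0 1" for \<alpha>
    proof (rule ex1I[of _ "\<omega> \<alpha>"])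
      show "\<omega> \<alpha> \<in> ball 0 1 \<and> \<not> is_pole \<Phi> (\<omega> \<alpha>) \<and> \<Phi> (\<omega> \<alpha>) = \<alpha>"
        using val[of "\<omega> \<alpha>" \<alpha>] norm_\<omega>_less[of \<alpha>] that by simp
      show "z = \<omega> \<alpha>" if "z \<in> ball 0 1 \<and> \<not> is_pole \<Phi> z \<and> \<Phi> z = \<alpha>" for z
        using val[of z \<alpha>] that \<open>\<alpha> \<in> ball 0 1\<close> by simp
    qed
    show "continuous_on (cball 0 1) \<omega>" by (rule continuous_on_\<omega>)
    show "\<omega> ` cball 0 1 \<subseteq> cball 0 1" using \<omega>_props(1) by auto
    show "\<omega> ` ball 0 1 \<subseteq> ball 0 1" using norm_\<omega>_less by auto
    show "\<omega> holomorphic_on ball 0 1" by (rule holomorphic_\<omega>)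
    show "\<not> is_pole \<Phi> (\<omega> z)" "\<Phi> (\<omega> z) = z" if "z \<in> ball 0 1" for z
      using val[of "\<omega> z" z] norm_\<omega>_less[of z] that by simp_all
    show "denjoy_wolff_point (g_map \<Phi> \<alpha>) w \<longleftrightarrow> w = \<omega> \<alpha>" if "\<alpha> \<in> cball 0 1" for \<alpha> w
      using that by (subst g, intro denjoy_wolff_point_iff_\<omega>) simp
    show "inj_on \<omega> (cball 0 1)" by (rule inj_on_\<omega>)
    show "\<exists>U h. open U \<and> \<zeta> \<in> U \<and> h holomorphic_on U \<and> (\<forall>z\<in>U \<inter> cball 0 1. h z = \<omega> z)"
      if "\<zeta> \<in> sphere 0 1" "norm (\<omega> \<zeta>) < 1" for \<zeta>
      using that by (intro \<omega>_continuation) auto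
  qed
qed

end
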